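(* Let $V=\bigoplus_{n\ge0}V^n$ be a vertex operator algebra over $\mathbb C$ of rank $c$ with $V^0=\mathbb C\mathbf 1$, $V^1=0$, and $\mathrm{Aut}\,V$ finite, and let $B=V^2$ be its Griess algebra. (1) If $V$ is of class $\mathcal S^2$ and $c\ne0$, then for any $a\in B$, $$\mathrm{Tr}\,o(a)q^{L_0}=\frac{2(a|\omega)}{c}\,q\frac{d}{dq}\,\mathrm{ch}\,V.$$ (2) If $V$ is of class $\mathcal S^4$ and $c(5c+22)\neq0$, then for any $a,b\in B$, $$\begin{aligned}\mathrm{Tr}\,o(a)o(b)q^{L_0}=\Bigg(&\frac{44(a|b)+20(a|\omega)(b|\omega)}{c(5c+22)}\Big(q\frac d{dq}\Big)^2-(11+60E_2)\frac{c(a|b)-2(a|\omega)(b|\omega)}{3c(5c+22)}\,q\frac d{dq}\\&+(11+120E_2-720E_4)\frac{c(a|b)-2(a|\omega)(b|\omega)}{144(5c+22)}\Bigg)\mathrm{ch}\,V.\end{aligned}$$ Here the traces are over the whole space $V$ (as formal power series in $q$).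
   Context: A VOA $V$ has products $a_{(n)}b$, vacuum $\mathbf 1$, conformal vector $\omega$, $L_m=\omega_{(m+1)}$; the rank is the central charge; $V^n$ is the (finite-dimensional) $L_0$-eigenspace with eigenvalue $n$; $V^{\le n}=\bigoplus_{m\le n}V^m$. The Griess algebra $B=V^2$ has product $ab=a_{(1)}b$ and bilinear form $(a|b)\mathbf 1=a_{(3)}b$. $\mathrm{Aut}\,V$ is the group of linear automorphisms preserving all products and fixing $\omega$. $V_\omega$ is the Virasoro submodule generated by $\mathbf 1$. $V$ is of class $\mathcal S^n$ if the action of $\mathrm{Aut}\,V$ on $V^{\le n}/(V_\omega\cap V^{\le n})$ has no nonzero fixed vector. For $u\in V^n$, $o(u)=u_{(n-1)}:V\to V$. $\mathrm{ch}\,V=\sum_{n\ge0}(\dim V^n)q^n$. The Eisenstein series are normalized as $E_{2k}(q)=-\frac{B_{2k}}{(2k)!}+\frac{2}{(2k-1)!}\sum_{n\ge1}\big(\sum_{m\mid n}m^{2k-1}\big)q^n$, with $\frac t{e^t-1}=\sum_m B_m\frac{t^m}{m!}$; so $E_2=-\frac1{12}+2q+6q^2+\cdots$ and $E_4=\frac1{720}+\frac13q+3q^2+\cdots$. *)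

theory Defs
  imports
    Complex_Main
    "HOL-Library.Groups_Big_Fun"
    "HOL-Computational_Algebra.Formal_Power_Series"
begin

text \<open>
  The underlying vector space is the whole type, with scalar multiplication \<open>smul V\<close>;
  \<open>mode V a n b\<close> is the product \<open>a\<^sub>(\<^sub>n\<^sub>) b\<close>.
\<close>

record 'v voa_data =
  smul :: "complex \<Rightarrow> 'v \<Rightarrow> 'v"
  mode :: "'v \<Rightarrow> int \<Rightarrow> 'v \<Rightarrow> 'v"
  vac :: 'v
  conf :: 'v

definition virasoro :: "'v voa_data \<Rightarrow> int \<Rightarrow> 'v \<Rightarrow> 'v" where
  "virasoro V m = mode V (conf V) (m + 1)"

definition weight_space :: "'v voa_data \<Rightarrow> nat \<Rightarrow> 'v set" where
  "weight_space V n = {v. virasoro V 0 v = smul V (of_nat n) v}"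

definition weight_space_upto :: "('v::ab_group_add) voa_data \<Rightarrow> nat \<Rightarrow> 'v set" where
  "weight_space_upto V n = module.span (smul V) (\<Union>m\<le>n. weight_space V m)"

text \<open>
  Vertex operator algebras of rank \<open>c\<close>. The sums in the Borcherds identity
  are over all \<open>i \<ge> 0\<close>; by truncation only finitely many terms are nonzero, so
  \<^const>\<open>Sum_any\<close> is the actual sum. The eigenspaces of \<open>L\<^sub>0\<close> for distinct eigenvalues are
  automatically independent, so \<open>grading\<close> says that \<open>V\<close> is their direct sum.
  The condition \<open>vac_nonzero\<close> excludes only the zero space, on which neither the rank nor
  the form \<open>(a|b)\<close> would be determined.
\<close>

locale vertex_operator_algebra =
  fixes V :: "('v::ab_group_add) voa_data" and c :: complex
  assumes vector_space: "vector_space (smul V)"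
    and mode_linear_left:
      "Vector_Spaces.linear (smul V) (smul V) (\<lambda>a. mode V a n b)"
    and mode_linear_right:
      "Vector_Spaces.linear (smul V) (smul V) (mode V a n)"
    and truncation: "\<exists>N. \<forall>n\<ge>N. mode V a n b = 0"
    and vac_nonzero: "vac V \<noteq> 0"
    and vac_mode: "mode V (vac V) n a = (if n = -1 then a else 0)"
    and creation: "mode V a (-1) (vac V) = a"
    and mode_vac: "n \<ge> 0 \<Longrightarrow> mode V a n (vac V) = 0"
    and borcherds:
      "Sum_any (\<lambda>i::nat. smul V ((of_int p :: complex) gchoose i)
          (mode V (mode V a (r + int i) b) (p + q - int i) u)) =
       Sum_any (\<lambda>i::nat. smul V ((-1) ^ i * ((of_int r :: complex) gchoose i))
          (mode V a (p + r - int i) (mode V b (q + int i) u)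
           - smul V ((-1) powi r)
               (mode V b (q + r - int i) (mode V a (p + int i) u))))"
    and virasoro_bracket:
      "virasoro V m (virasoro V n a) - virasoro V n (virasoro V m a) =
       smul V (of_int (m - n)) (virasoro V (m + n) a)
       + smul V (if m + n = 0 then of_int (m ^ 3 - m) / 12 * c else 0) a"
    and translation:
      "mode V (virasoro V (-1) a) n b = smul V (- of_int n) (mode V a (n - 1) b)"
    and grading: "module.span (smul V) (\<Union>n. weight_space V n) = UNIV"
    and weight_space_finite:
      "\<exists>S. finite S \<and> weight_space V n \<subseteq> module.span (smul V) S"

definition Aut :: "('v::ab_group_add) voa_data \<Rightarrow> ('v \<Rightarrow> 'v) set" where
  "Aut V = {g. Vector_Spaces.linear (smul V) (smul V) g \<and> bij g \<and>
      (\<forall>a n b. g (mode V a n b) = mode V (g a) n (g b)) \<and> g (conf V) = conf V}"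

definition virasoro_submodule :: "('v::ab_group_add) voa_data \<Rightarrow> 'v set" where
  "virasoro_submodule V =
     (\<lambda>W. module.subspace (smul V) W \<and> (\<forall>m. \<forall>w\<in>W. virasoro V m w \<in> W)) hull {vac V}"

text \<open>
  The elements of \<open>V\<^sup>\<le>\<^sup>n / (V\<^sub>\<omega> \<inter> V\<^sup>\<le>\<^sup>n)\<close> are cosets; an automorphism acts on them by direct image,
  and the zero vector is the coset \<open>V\<^sub>\<omega> \<inter> V\<^sup>\<le>\<^sup>n\<close> itself.
\<close>

definition class_S_quotient :: "('v::ab_group_add) voa_data \<Rightarrow> nat \<Rightarrow> 'v set set" where
  "class_S_quotient V n =
     weight_space_upto V n //
       {(u, v). u \<in> weight_space_upto V n \<and> v \<in> weight_space_upto V n \<and>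
                u - v \<in> virasoro_submodule V \<inter> weight_space_upto V n}"

definition class_S :: "('v::ab_group_add) voa_data \<Rightarrow> nat \<Rightarrow> bool" where
  "class_S V n \<longleftrightarrow>
     (\<forall>X \<in> class_S_quotient V n. (\<forall>g \<in> Aut V. g ` X = X) \<longrightarrow>
        X = virasoro_submodule V \<inter> weight_space_upto V n)"

definition griess :: "'v voa_data \<Rightarrow> 'v set" where
  "griess V = weight_space V 2"

definition griess_form :: "'v voa_data \<Rightarrow> 'v \<Rightarrow> 'v \<Rightarrow> complex" where
  "griess_form V a b = (THE z. mode V a 3 b = smul V z (vac V))"

text \<open>The operator \<open>o(u)\<close> for \<open>u\<close> homogeneous of weight \<open>n\<close>.\<close>

definition zero_mode :: "'v voa_data \<Rightarrow> nat \<Rightarrow> 'v \<Rightarrow> 'v \<Rightarrow> 'v" where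
  "zero_mode V n u = mode V u (int n - 1)"

text \<open>
  Trace of an endomorphism \<open>f\<close> of a finite-dimensional subspace \<open>W\<close>: the sum of the diagonal
  entries in a basis of \<open>W\<close>.
\<close>

definition trace_on ::
    "(complex \<Rightarrow> 'v \<Rightarrow> 'v) \<Rightarrow> ('v::ab_group_add) set \<Rightarrow> ('v \<Rightarrow> 'v) \<Rightarrow> complex" where
  "trace_on s W f =
     (let B = (SOME B. \<not> module.dependent s B \<and> module.span s B = W)
      in \<Sum>b\<in>B. module.representation s B (f b) b)"

text \<open>The series \<open>Tr f q\<^sup>L\<^sup>0\<close>, for \<open>f\<close> preserving all weight spaces.\<close>

definition graded_trace :: "('v::ab_group_add) voa_data \<Rightarrow> ('v \<Rightarrow> 'v) \<Rightarrow> complex fps" where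
  "graded_trace V f = Abs_fps (\<lambda>n. trace_on (smul V) (weight_space V n) f)"

definition ch :: "('v::ab_group_add) voa_data \<Rightarrow> complex fps" where
  "ch V = Abs_fps (\<lambda>n. of_nat (vector_space.dim (smul V) (weight_space V n)))"

definition q_deriv :: "complex fps \<Rightarrow> complex fps" where
  "q_deriv f = fps_X * fps_deriv f"

definition bernoulli_number :: "nat \<Rightarrow> complex" where
  "bernoulli_number m = fact m * fps_nth (fps_X / (fps_exp 1 - 1)) m"

text \<open>The argument is the (even) weight: \<open>eisenstein 2\<close> is \<open>E\<^sub>2\<close> and \<open>eisenstein 4\<close> is \<open>E\<^sub>4\<close>.\<close>

definition eisenstein :: "nat \<Rightarrow> complex fps" where
  "eisenstein k = Abs_fps (\<lambda>n.
     if n = 0 then - bernoulli_number k / fact k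
     else 2 / fact (k - 1) * of_nat (\<Sum>m | m dvd n. m ^ (k - 1)))"

end

theory Submission
  imports Defs
begin

text \<open>
  Why the formulae hold. The trace of a zero mode is invariant under automorphisms, because
  \<open>o(g u) = g o(u) g\<^sup>-\<^sup>1\<close>. So \<open>u\<close> may be replaced by its average over the finite group \<open>Aut V\<close>
  (\<open>gtr_avg\<close>). The class of the average in \<open>V\<^sup>\<le>\<^sup>n / (V\<^sub>\<omega> \<inter> V\<^sup>\<le>\<^sup>n)\<close> is fixed, so the average lies in
  \<open>V\<^sub>\<omega>\<close> (\<open>class_S_invariant\<close>). In weight \<open>2\<close> the space \<open>V\<^sub>\<omega>\<close> is spanned by \<open>\<omega>\<close>, in weight \<open>4\<close> by \<open>L\<^sub>-\<^sub>2 \<omega>\<close> and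
  \<open>L\<^sub>-\<^sub>4 \<one>\<close>, and the coefficients are found with \<open>L\<^sub>2\<close>, respectively with \<open>L\<^sub>2\<^sup>2\<close> and \<open>L\<^sub>4\<close>
  (\<open>avg_griess\<close>, \<open>avg_normal_product\<close>). The first formula follows, since \<open>o(\<omega>) = L\<^sub>0\<close>.

  For the second formula the product \<open>o(a) o(b)\<close> is first reduced to single zero modes. This is
  Zhu's recursion, proved directly in \<open>trace_recursion\<close>: cyclicity of the trace gives \<open>1 - q\<^sup>k\<close>
  times the trace of \<open>a\<^sub>(\<^sub>1\<^sub>+\<^sub>k\<^sub>) b\<^sub>(\<^sub>1\<^sub>-\<^sub>k\<^sub>) q\<^bsup>L\<^sub>0\<^esup>\<close> as a trace of zero modes of the products \<open>a\<^sub>(\<^sub>i\<^sub>) b\<close>, \<open>i \<ge> 0\<close>, and the sum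
  over \<open>k\<close> of these traces is the trace of \<open>o(a\<^sub>(\<^sub>-\<^sub>1\<^sub>) b)\<close>. The denominators \<open>1 - q\<^sup>k\<close> turn into divisor
  sums, that is, into \<open>E\<^sub>2\<close> and \<open>E\<^sub>4\<close>. After averaging, the only unknown trace is that of
  \<open>o(L\<^sub>-\<^sub>2 \<omega>)\<close>. The recursion with \<open>a = b = \<omega>\<close>, whose left side is the trace of \<open>L\<^sub>0\<^sup>2 q\<^bsup>L\<^sub>0\<^esup>\<close>, determines it.

  One part of the work precedes all this. In the axioms on linearity, on the modes of \<open>\<one>\<close>, on
  translation and in the second index of the Virasoro relation, the index \<open>n\<close> is a natural number, so nothing is
  assumed there about modes with negative index. What is needed of it is recovered from the
  Borcherds identity, which holds for all integers, together with \<open>V\<^sup>0 = \<complex> \<one>\<close> and \<open>c \<noteq> 0\<close>. The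
  key is \<open>mode_linear_on_image\<close>: every vector \<open>w\<^sub>(\<^sub>q\<^sub>) a\<^sub>(\<^sub>i\<^sub>) u\<close> with \<open>i \<ge> 0\<close> is linear in \<open>u\<close>. With
  \<open>a\<^sub>(\<^sub>i\<^sub>) = L\<^sub>0\<close> this gives linearity on all nonzero weights, and \<open>L\<^sub>2 \<omega> = (c/2) \<one>\<close> gives it on \<open>V\<^sup>0\<close>.
\<close>

section \<open>Traces on finite-dimensional subspaces\<close>

locale complex_vector_space = vector_space scale
  for scale :: "complex \<Rightarrow> 'v::ab_group_add \<Rightarrow> 'v"
begin

definition fin_dim_subspace :: "'v set \<Rightarrow> bool" where
  "fin_dim_subspace W \<longleftrightarrow> subspace W \<and> (\<exists>S. finite S \<and> W \<subseteq> span S)"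

text \<open>The basis chosen in \<^const>\<open>trace_on\<close>, so that traces are sums over it.\<close>

definition some_basis :: "'v set \<Rightarrow> 'v set" where
  "some_basis W = (SOME B. independent B \<and> span B = W)"

lemma some_basis:
  assumes "fin_dim_subspace W"
  shows "independent (some_basis W)" "span (some_basis W) = W" "finite (some_basis W)"
proof -
  have sub: "subspace W" using assms by (simp add: fin_dim_subspace_def)
  obtain S where S: "finite S" "W \<subseteq> span S" using assms by (auto simp: fin_dim_subspace_def)
  obtain B where "B \<subseteq> W" "independent B" "W \<subseteq> span B"
    using basis_exists[of W] by metis
  then have "independent B \<and> span B = W"
    by (metis sub span_subspace)
  then have *: "independent (some_basis W) \<and> span (some_basis W) = W"
    unfolding some_basis_def by (rule someI)
  then show "independent (some_basis W)" "span (some_basis W) = W" by auto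
  have "some_basis W \<subseteq> span S" using * S span_superset by blast
  then show "finite (some_basis W)" using * S independent_span_bound by blast
qed

lemma trace_on_basis: "trace_on scale W f =
    (\<Sum>b\<in>some_basis W. representation (some_basis W) (f b) b)"
  by (simp add: trace_on_def some_basis_def Let_def)

lemma basis_in: "fin_dim_subspace W \<Longrightarrow> b \<in> some_basis W \<Longrightarrow> b \<in> W"
  using some_basis(2) span_base by metis

lemma trace_on_cong:
  assumes "fin_dim_subspace W" "\<And>v. v \<in> W \<Longrightarrow> f v = g v"
  shows "trace_on scale W f = trace_on scale W g"
  unfolding trace_on_basis using assms basis_in by (auto intro!: sum.cong)

lemma trace_on_add:
  assumes W: "fin_dim_subspace W" and "\<And>v. v \<in> W \<Longrightarrow> f v \<in> W" "\<And>v. v \<in> W \<Longrightarrow> g v \<in> W"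
  shows "trace_on scale W (\<lambda>v. f v + g v) = trace_on scale W f + trace_on scale W g"
  unfolding trace_on_basis sum.distrib[symmetric]
  by (rule sum.cong) (use assms some_basis[OF W] basis_in[OF W] in \<open>simp_all add: representation_add\<close>)

lemma trace_on_scale:
  assumes W: "fin_dim_subspace W" and "\<And>v. v \<in> W \<Longrightarrow> f v \<in> W"
  shows "trace_on scale W (\<lambda>v. scale z (f v)) = z * trace_on scale W f"
  unfolding trace_on_basis sum_distrib_left
  by (rule sum.cong) (use assms some_basis[OF W] basis_in[OF W] in \<open>simp_all add: representation_scale\<close>)

lemma trace_on_zero:
  assumes W: "fin_dim_subspace W"
  shows "trace_on scale W (\<lambda>v. 0) = 0"
  unfolding trace_on_basis by (simp add: representation_zero)

lemma trace_on_sum: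
  assumes W: "fin_dim_subspace W" and "finite A" "\<And>i v. i \<in> A \<Longrightarrow> v \<in> W \<Longrightarrow> f i v \<in> W"
  shows "trace_on scale W (\<lambda>v. \<Sum>i\<in>A. f i v) = (\<Sum>i\<in>A. trace_on scale W (f i))"
  using assms(2,3)
proof (induction A)
  case empty
  then show ?case using trace_on_zero[OF W] by simp
next
  case (insert i A)
  have "subspace W" using W by (simp add: fin_dim_subspace_def)
  then have "\<And>v. v \<in> W \<Longrightarrow> (\<Sum>i\<in>A. f i v) \<in> W" using insert.prems by (auto intro: subspace_sum)
  then show ?case using insert by (simp add: trace_on_add[OF W])
qed

lemma trace_on_scalar:
  assumes W: "fin_dim_subspace W"
  shows "trace_on scale W (scale z) = z * of_nat (dim W)"
proof -
  have "dim W = card (some_basis W)"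
    using dim_span_eq_card_independent[OF some_basis(1)[OF W]] some_basis(2)[OF W] by simp
  moreover have "trace_on scale W (scale z) = (\<Sum>b\<in>some_basis W. z)"
    unfolding trace_on_basis
    by (rule sum.cong)
      (use some_basis[OF W] span_base in \<open>auto simp: representation_scale representation_basis\<close>)
  ultimately show ?thesis by simp
qed

definition linear_on :: "'v set \<Rightarrow> ('v \<Rightarrow> 'v) \<Rightarrow> bool" where
  "linear_on W f \<longleftrightarrow> (\<forall>u\<in>W. \<forall>v\<in>W. \<forall>x y.
     f (scale x u + scale y v) = scale x (f u) + scale y (f v))"

lemma linear_onD:
  assumes "linear_on W f" "u \<in> W" "v \<in> W"
  shows "f (scale x u + scale y v) = scale x (f u) + scale y (f v)"
    and "f (u + v) = f u + f v" and "f (scale x u) = scale x (f u)"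
proof -
  show *: "f (scale x u + scale y v) = scale x (f u) + scale y (f v)" for x y
    using assms by (auto simp: linear_on_def)
  show "f (u + v) = f u + f v" using *[of 1 1] by simp
  show "f (scale x u) = scale x (f u)" using *[of x 0] by simp
qed

lemma linear_on_sum:
  assumes W: "subspace W" and f: "linear_on W f" and "finite A" "A \<subseteq> W"
  shows "f (\<Sum>b\<in>A. scale (z b) b) = (\<Sum>b\<in>A. scale (z b) (f b))"
  using assms(3,4)
proof (induction A)
  case empty
  then show ?case using linear_onD(3)[OF f, of 0 0 0] subspace_0[OF W] by simp
next
  case (insert b A)
  then have "(\<Sum>b\<in>A. scale (z b) b) \<in> W" "scale (z b) b \<in> W" "b \<in> W"
    using W by (auto intro!: subspace_sum subspace_scale)
  then show ?case using insert by (simp add: linear_onD(2,3)[OF f])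
qed

text \<open>
  Both sides expand into the same double sum of matrix entries in the two chosen bases. With
  \<open>U = W\<close> this also covers conjugation.
\<close>

lemma trace_on_cyclic:
  assumes W: "fin_dim_subspace W" and U: "fin_dim_subspace U"
    and f: "linear_on W f" and g: "linear_on U g"
    and fWU: "\<And>v. v \<in> W \<Longrightarrow> f v \<in> U" and gUW: "\<And>v. v \<in> U \<Longrightarrow> g v \<in> W"
  shows "trace_on scale W (\<lambda>v. g (f v)) = trace_on scale U (\<lambda>v. f (g v))"
proof -
  have expand: "trace_on scale W (\<lambda>v. g (f v)) =
      (\<Sum>b\<in>some_basis W. \<Sum>e\<in>some_basis U.
         representation (some_basis U) (f b) e * representation (some_basis W) (g e) b)"
    if W: "fin_dim_subspace W" and U: "fin_dim_subspace U" and g: "linear_on U g"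
      and fWU: "\<And>v. v \<in> W \<Longrightarrow> f v \<in> U" and gUW: "\<And>v. v \<in> U \<Longrightarrow> g v \<in> W"
    for W U f g
    unfolding trace_on_basis
  proof (rule sum.cong)
    fix b assume b: "b \<in> some_basis W"
    have subU: "subspace U" and subW: "subspace W" using U W by (simp_all add: fin_dim_subspace_def)
    let ?r = "representation (some_basis U) (f b)"
    have "f b \<in> span (some_basis U)" using b W U fWU basis_in some_basis(2) by simp
    then have "f b = (\<Sum>e\<in>some_basis U. scale (?r e) e)"
      using sum_representation_eq[of "some_basis U" "f b" "some_basis U"] some_basis[OF U] by simp
    then have "g (f b) = (\<Sum>e\<in>some_basis U. scale (?r e) (g e))"
      using linear_on_sum[OF subU g some_basis(3)[OF U], of ?r] basis_in[OF U] by auto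
    moreover have "representation (some_basis W) (\<Sum>e\<in>some_basis U. scale (?r e) (g e)) =
        (\<lambda>b'. \<Sum>e\<in>some_basis U. representation (some_basis W) (scale (?r e) (g e)) b')"
      by (rule representation_sum)
        (use some_basis[OF W] gUW basis_in[OF U] subW in \<open>auto intro: subspace_scale\<close>)
    moreover have "representation (some_basis W) (scale z (g e)) =
        (\<lambda>b'. z * representation (some_basis W) (g e) b')" if "e \<in> some_basis U" for e z
      by (rule representation_scale) (use some_basis[OF W] gUW basis_in[OF U] that in auto)
    ultimately show "representation (some_basis W) (g (f b)) b = (\<Sum>e\<in>some_basis U.
         ?r e * representation (some_basis W) (g e) b)"
      by simp
  qed simp
  show ?thesis
    using expand[of W U g f] expand[of U W f g] assms
    by (simp add: sum.swap[of _ "some_basis W"] mult.commute)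
qed

text \<open>An element of a span of a union of subspaces is a sum of members of the subspaces.\<close>

lemma span_UN_sum:
  fixes D :: "nat \<Rightarrow> 'v set"
  assumes "\<And>n. subspace (D n)" "v \<in> span (\<Union>n. D n)"
  shows "\<exists>N f. (\<forall>n. f n \<in> D n) \<and> (\<forall>n>N. f n = 0) \<and> v = (\<Sum>n\<le>N. f n)"
  using assms(2)
proof (induction rule: span_induct_alt)
  case base
  show ?case using assms(1) by (intro exI[of _ 0] exI[of _ "\<lambda>_. 0"]) (auto simp: subspace_0)
next
  case (step z x y)
  obtain N f where f: "\<forall>n. f n \<in> D n" "\<forall>n>N. f n = 0" "y = (\<Sum>n\<le>N. f n)" using step by auto
  obtain m where m: "x \<in> D m" using step by auto
  define f' where "f' n = f n + (if n = m then scale z x else 0)" for n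
  have "(\<Sum>n\<le>max N m. f n) = (\<Sum>n\<le>N. f n)"
    by (rule sum.mono_neutral_right) (use f(2) in auto)
  moreover have "(\<Sum>n\<le>max N m. if n = m then scale z x else 0) = scale z x"
    by (subst sum.delta) auto
  ultimately have "scale z x + y = (\<Sum>n\<le>max N m. f' n)"
    by (simp add: f'_def sum.distrib f(3))
  moreover have "\<forall>n. f' n \<in> D n"
    using f(1) m assms(1) by (auto simp: f'_def intro: subspace_add subspace_scale)
  moreover have "\<forall>n>max N m. f' n = 0" using f(2) by (auto simp: f'_def)
  ultimately show ?case by blast
qed

text \<open>The binomial coefficients are independent as functions of \<open>r\<close>, by taking differences.\<close>

lemma gbinomial_independent:
  assumes "\<And>r::int. r \<le> R \<Longrightarrow> (\<Sum>i<I. scale ((of_int r :: complex) gchoose i) (x i)) = 0" "j < I"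
  shows "x j = 0"
  using assms
proof (induction I arbitrary: x R j)
  case (Suc I)
  have diff: "(\<Sum>i<I. scale ((of_int r :: complex) gchoose i) (x (Suc i))) = 0" if "r \<le> R - 1" for r :: int
  proof -
    have "(\<Sum>i<Suc I. scale ((of_int (r + 1) :: complex) gchoose i) (x i))
        - (\<Sum>i<Suc I. scale ((of_int r :: complex) gchoose i) (x i)) = 0"
      using Suc.prems(1)[of r] Suc.prems(1)[of "r + 1"] that by (simp only:) simp
    then show ?thesis
      by (simp only: sum.lessThan_Suc_shift gbinomial_0 o_def of_int_add of_int_1 gbinomial_Suc_Suc)
        (simp add: scale_left_distrib sum.distrib)
  qed
  have tail: "x (Suc i) = 0" if "i < I" for i
    using Suc.IH[of "R - 1" "\<lambda>i. x (Suc i)" i] diff that by blast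
  have "x 0 = 0"
    using Suc.prems(1)[of R] tail by (simp add: sum.lessThan_Suc_shift del: sum.lessThan_Suc)
  then show ?case using tail Suc.prems(2) by (cases j) auto
qed simp

end

section \<open>Divisor sums and Eisenstein series\<close>

text \<open>The series \<open>q\<^sup>k / (1 - q\<^sup>k)\<close>.\<close>

definition multiples_series :: "nat \<Rightarrow> complex fps" where
  "multiples_series k = Abs_fps (\<lambda>m. if m > 0 \<and> k dvd m then 1 else 0)"

definition divisor_series :: "(nat \<Rightarrow> complex) \<Rightarrow> complex fps" where
  "divisor_series w = Abs_fps (\<lambda>m. if m = 0 then 0 else \<Sum>k | k dvd m. w k)"

lemma multiples_series:
  assumes "k > 0"
  shows "(1 - fps_X ^ k) * multiples_series k = fps_X ^ k"
proof (rule fps_ext)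
  fix n
  have "(1 - fps_X ^ k) * multiples_series k = multiples_series k - fps_X ^ k * multiples_series k"
    by (simp add: algebra_simps)
  moreover have "k dvd n \<longleftrightarrow> k dvd (n - k)" if "n \<ge> k"
    using that by (simp add: dvd_minus_self)
  ultimately show "fps_nth ((1 - fps_X ^ k) * multiples_series k) n = fps_nth (fps_X ^ k) n"
    using assms by (auto simp: multiples_series_def fps_X_power_mult_nth fps_X_power_nth dest: dvd_imp_le)
qed

lemma one_minus_X_power: "k > 0 \<Longrightarrow> 1 - fps_X ^ k \<noteq> (0 :: complex fps)"
proof
  assume "k > 0" "1 - fps_X ^ k = (0 :: complex fps)"
  then have "fps_nth (1 - fps_X ^ k :: complex fps) 0 = 0" by simp
  then show False using \<open>k > 0\<close> by (simp add: fps_X_power_nth)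
qed

lemma geometric_solution:
  fixes U M :: "complex fps"
  assumes "k > 0" "(1 - fps_X ^ k) * U = M"
  shows "fps_X ^ k * U = multiples_series k * M"
proof -
  have "(1 - fps_X ^ k) * (fps_X ^ k * U) = fps_X ^ k * ((1 - fps_X ^ k) * U)" by (simp add: mult.left_commute)
  also have "\<dots> = (1 - fps_X ^ k) * multiples_series k * M"
    by (simp only: assms(2) multiples_series[OF assms(1)])
  finally have "(1 - fps_X ^ k) * (fps_X ^ k * U) = (1 - fps_X ^ k) * (multiples_series k * M)"
    by (simp only: mult.assoc)
  then show ?thesis using one_minus_X_power[OF assms(1)] by simp
qed

text \<open>Lambert series: only the terms with \<open>k \<le> n\<close> contribute to the coefficient of \<open>q\<^sup>n\<close>.\<close>

lemma sum_multiples_series: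
  "(\<Sum>k=1..n. fps_nth (multiples_series k * (fps_const (w k) * Z)) n) = fps_nth (divisor_series w * Z) n"
proof -
  have "(\<Sum>k=1..n. fps_nth (multiples_series k * (fps_const (w k) * Z)) n) =
      (\<Sum>k=1..n. \<Sum>m=0..n. fps_nth (multiples_series k) m * w k * fps_nth Z (n - m))"
    by (intro sum.cong refl, subst fps_mult_nth) (simp add: mult.assoc)
  also have "\<dots> = (\<Sum>m=0..n. (\<Sum>k=1..n. fps_nth (multiples_series k) m * w k) * fps_nth Z (n - m))"
    by (subst sum.swap) (simp add: sum_distrib_right)
  also have "\<dots> = (\<Sum>m=0..n. fps_nth (divisor_series w) m * fps_nth Z (n - m))"
  proof (rule sum.cong)
    fix m assume m: "m \<in> {0..n}"
    have "(\<Sum>k=1..n. fps_nth (multiples_series k) m * w k) = fps_nth (divisor_series w) m"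
    proof (cases "m = 0")
      case False
      have "(\<Sum>k=1..n. fps_nth (multiples_series k) m * w k) = (\<Sum>k=1..n. if k dvd m then w k else 0)"
        using False by (intro sum.cong) (simp_all add: multiples_series_def)
      also have "\<dots> = (\<Sum>k | k \<in> {1..n} \<and> k dvd m. w k)"
        by (subst sum.inter_filter[symmetric]) auto
      also have "{k. k \<in> {1..n} \<and> k dvd m} = {k. k dvd m}"
        using m False by (auto dest: dvd_imp_le intro: Suc_leI dvd_pos_nat)
      finally show ?thesis using False by (simp add: divisor_series_def)
    qed (simp add: multiples_series_def divisor_series_def)
    then show "(\<Sum>k=1..n. fps_nth (multiples_series k) m * w k) * fps_nth Z (n - m) =
        fps_nth (divisor_series w) m * fps_nth Z (n - m)" by simp
  qed simp
  also have "\<dots> = fps_nth (divisor_series w * Z) n" by (simp add: fps_mult_nth)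
  finally show ?thesis .
qed

text \<open>The coefficients of \<open>t / (e\<^sup>t - 1)\<close> are found by comparing coefficients in \<open>B \<cdot> (e\<^sup>t - 1) = t\<close>.\<close>

lemma bernoulli_numbers: "bernoulli_number 2 = 1 / 6" "bernoulli_number 4 = - 1 / 30"
proof -
  let ?e = "fps_exp 1 - 1 :: complex fps"
  define B where "B = fps_X / ?e"
  have "fps_nth ?e 1 = 1" "fps_nth ?e 0 = 0" by simp_all
  then have "subdegree ?e = 1" by (intro subdegreeI) auto
  moreover have "?e \<noteq> 0" using \<open>fps_nth ?e 1 = 1\<close> by (metis fps_zero_nth zero_neq_one)
  ultimately have "?e dvd fps_X" by (simp add: fps_dvd_iff)
  then have "B * ?e = fps_X" unfolding B_def by simp
  then have c: "fps_nth (B * ?e) n = (if n = 1 then 1 else 0)" for n by simp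
  have "fps_nth B 0 = 1" "fps_nth B 0 / 2 + fps_nth B 1 = 0"
    "fps_nth B 0 / 6 + fps_nth B 1 / 2 + fps_nth B 2 = 0"
    "fps_nth B 0 / 24 + fps_nth B 1 / 6 + fps_nth B 2 / 2 + fps_nth B 3 = 0"
    "fps_nth B 0 / 120 + fps_nth B 1 / 24 + fps_nth B 2 / 6 + fps_nth B 3 / 2 + fps_nth B 4 = 0"
    using c[of 1] c[of 2] c[of 3] c[of 4] c[of 5]
    by (simp_all add: fps_mult_nth eval_nat_numeral add.assoc)
  then have b2: "fps_nth B 2 = 1 / 12" and b4: "fps_nth B 4 = - (1 / 720)"
    by algebra+
  show "bernoulli_number 2 = 1 / 6" "bernoulli_number 4 = - 1 / 30"
    unfolding bernoulli_number_def B_def[symmetric] b2 b4 by (simp_all add: fact_numeral)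
qed

lemma eisenstein_2: "60 * eisenstein 2 = fps_const 120 * divisor_series of_nat - 5"
proof (rule fps_ext)
  fix n show "fps_nth (60 * eisenstein 2) n = fps_nth (fps_const 120 * divisor_series of_nat - 5) n"
    by (auto simp: eisenstein_def divisor_series_def bernoulli_numbers numeral_fps_const fact_numeral)
qed

lemma eisenstein_4: "720 * eisenstein 4 = fps_const 240 * divisor_series (\<lambda>k. of_nat k ^ 3) + 1"
proof (rule fps_ext)
  fix n show "fps_nth (720 * eisenstein 4) n = fps_nth (fps_const 240 * divisor_series (\<lambda>k. of_nat k ^ 3) + 1) n"
    by (auto simp: eisenstein_def divisor_series_def bernoulli_numbers numeral_fps_const fact_numeral)
qed

lemma q_deriv_nth: "fps_nth (q_deriv f) n = of_nat n * fps_nth f n"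
  by (cases n) (simp_all add: q_deriv_def)

section \<open>The vacuum, the commutator formula and the iterate formula\<close>

lemma Sum_any_eq_sum: "finite A \<Longrightarrow> (\<And>i. i \<notin> A \<Longrightarrow> g i = 0) \<Longrightarrow> Sum_any g = sum g A"
  by (rule Sum_any.expand_superset) blast+

lemma gbinomial_minus_one: "(- 1 :: 'a::field_char_0) gchoose i = (- 1) ^ i"
  using gbinomial_minus[of "1::'a" i] binomial_gbinomial[of i i, where 'a = 'a] by simp

sublocale vertex_operator_algebra \<subseteq> complex_vector_space "smul V"
  by (simp add: complex_vector_space_def vector_space)

context vertex_operator_algebra
begin

abbreviation scale_V (infixr "\<cdot>" 75) where "z \<cdot> v \<equiv> smul V z v"
abbreviation mode_V ("_\<^bsub>'(_')\<^esub> _" [90, 0, 90] 90) where "a\<^bsub>(n)\<^esub> b \<equiv> mode V a n b"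
abbreviation (input) L where "L \<equiv> virasoro V"
abbreviation vacuum ("\<one>") where "\<one> \<equiv> vac V"
abbreviation (input) conformal ("\<omega>") where "\<omega> \<equiv> conf V"

lemma mode_nonneg_left:
  assumes "n \<ge> 0"
  shows "(x \<cdot> a + y \<cdot> a')\<^bsub>(n)\<^esub> b = x \<cdot> a\<^bsub>(n)\<^esub> b + y \<cdot> a'\<^bsub>(n)\<^esub> b"
    "(a + a')\<^bsub>(n)\<^esub> b = a\<^bsub>(n)\<^esub> b + a'\<^bsub>(n)\<^esub> b" "(a - a')\<^bsub>(n)\<^esub> b = a\<^bsub>(n)\<^esub> b - a'\<^bsub>(n)\<^esub> b"
    "(x \<cdot> a)\<^bsub>(n)\<^esub> b = x \<cdot> a\<^bsub>(n)\<^esub> b"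
proof -
  obtain m where m: "n = int m" using assms nonneg_int_cases by blast
  have 1: "(a + a')\<^bsub>(n)\<^esub> b = a\<^bsub>(n)\<^esub> b + a'\<^bsub>(n)\<^esub> b" "(x \<cdot> a)\<^bsub>(n)\<^esub> b = x \<cdot> a\<^bsub>(n)\<^esub> b" for a a' x
    using mode_linear_left[of m b] by (simp_all add: Vector_Spaces.linear_iff m)
  show "(a + a')\<^bsub>(n)\<^esub> b = a\<^bsub>(n)\<^esub> b + a'\<^bsub>(n)\<^esub> b" "(x \<cdot> a)\<^bsub>(n)\<^esub> b = x \<cdot> a\<^bsub>(n)\<^esub> b"
    "(x \<cdot> a + y \<cdot> a')\<^bsub>(n)\<^esub> b = x \<cdot> a\<^bsub>(n)\<^esub> b + y \<cdot> a'\<^bsub>(n)\<^esub> b" by (simp_all add: 1)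
  show "(a - a')\<^bsub>(n)\<^esub> b = a\<^bsub>(n)\<^esub> b - a'\<^bsub>(n)\<^esub> b"
    by (metis 1(1) add_diff_cancel_right' diff_add_cancel)
qed

lemma mode_nonneg_right:
  assumes "n \<ge> 0"
  shows "a\<^bsub>(n)\<^esub> (x \<cdot> b + y \<cdot> b') = x \<cdot> a\<^bsub>(n)\<^esub> b + y \<cdot> a\<^bsub>(n)\<^esub> b'"
    "a\<^bsub>(n)\<^esub> (b + b') = a\<^bsub>(n)\<^esub> b + a\<^bsub>(n)\<^esub> b'" "a\<^bsub>(n)\<^esub> (b - b') = a\<^bsub>(n)\<^esub> b - a\<^bsub>(n)\<^esub> b'"
    "a\<^bsub>(n)\<^esub> (x \<cdot> b) = x \<cdot> a\<^bsub>(n)\<^esub> b"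
proof -
  obtain m where m: "n = int m" using assms nonneg_int_cases by blast
  have 1: "a\<^bsub>(n)\<^esub> (b + b') = a\<^bsub>(n)\<^esub> b + a\<^bsub>(n)\<^esub> b'" "a\<^bsub>(n)\<^esub> (x \<cdot> b) = x \<cdot> a\<^bsub>(n)\<^esub> b" for b b' x
    using mode_linear_right[of a m] by (simp_all add: Vector_Spaces.linear_iff m)
  show "a\<^bsub>(n)\<^esub> (b + b') = a\<^bsub>(n)\<^esub> b + a\<^bsub>(n)\<^esub> b'" "a\<^bsub>(n)\<^esub> (x \<cdot> b) = x \<cdot> a\<^bsub>(n)\<^esub> b"
    "a\<^bsub>(n)\<^esub> (x \<cdot> b + y \<cdot> b') = x \<cdot> a\<^bsub>(n)\<^esub> b + y \<cdot> a\<^bsub>(n)\<^esub> b'" by (simp_all add: 1)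
  show "a\<^bsub>(n)\<^esub> (b - b') = a\<^bsub>(n)\<^esub> b - a\<^bsub>(n)\<^esub> b'"
    by (metis 1(1) add_diff_cancel_right' diff_add_cancel)
qed

lemma vac_mode_nonneg: "n \<ge> 0 \<Longrightarrow> \<one>\<^bsub>(n)\<^esub> a = 0"
  using vac_mode[of "nat n" a] by simp

lemma mode_vac_nonneg: "n \<ge> 0 \<Longrightarrow> a\<^bsub>(n)\<^esub> \<one> = 0"
  using mode_vac[of "nat n" a] by simp

lemma double_eq_zero: "x = - x \<Longrightarrow> x = 0" for x :: 'v
proof -
  assume "x = - x"
  then have "x + x = 0" by (metis add.right_inverse)
  then have "(2 :: complex) \<cdot> x = 0"
    using scale_left_distrib[of 1 1 x] by simp
  then show "x = 0" by simp
qed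

text \<open>
  The instance \<open>p = r = 0\<close> of the Borcherds identity with \<open>a = \<one>\<close> reads \<open>0\<^sub>(\<^sub>q\<^sub>) u = - b\<^sub>(\<^sub>q\<^sub>) 0\<close>
  for all \<open>b\<close> and \<open>u\<close>; taking \<open>b = u = 0\<close> shows that both sides vanish. Only after this do the
  sums in the Borcherds identity become finite.
\<close>

lemma mode_zero [simp]: "0\<^bsub>(q)\<^esub> u = 0" "b\<^bsub>(q)\<^esub> 0 = 0"
proof -
  have *: "0\<^bsub>(q)\<^esub> u = - (b\<^bsub>(q)\<^esub> 0)" for b u
  proof -
    let ?f = "\<lambda>i::nat. smul V ((of_int 0 :: complex) gchoose i)
          (mode V (mode V \<one> (0 + int i) b) (0 + q - int i) u)"
    let ?g = "\<lambda>i::nat. smul V ((-1) ^ i * ((of_int 0 :: complex) gchoose i))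
          (mode V \<one> (0 + 0 - int i) (mode V b (q + int i) u)
           - smul V ((-1) powi 0)
               (mode V b (q + 0 - int i) (mode V \<one> (0 + int i) u)))"
    have "Sum_any ?f = sum ?f {0}" "Sum_any ?g = sum ?g {0}"
      by (rule Sum_any_eq_sum; simp add: gbinomial_0_left)+
    then show ?thesis using borcherds[of 0 \<one> 0 b q u] by (simp add: vac_mode_nonneg)
  qed
  have "0\<^bsub>(q)\<^esub> 0 = 0" using *[of 0 0] by (rule double_eq_zero)
  then show "0\<^bsub>(q)\<^esub> u = 0" using *[of u 0] by simp
  then show "b\<^bsub>(q)\<^esub> 0 = 0" using *[of u b] by simp
qed

text \<open>
  The next lemmas are the cases \<open>r = 0\<close> and \<open>p = 0\<close> of the Borcherds identity, with the sums cut off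
  by truncation, respectively by vanishing binomial coefficients.
\<close>

lemma commutator:
  assumes "\<And>i. i \<ge> N \<Longrightarrow> a\<^bsub>(int i)\<^esub> b = 0"
  shows "a\<^bsub>(p)\<^esub> (b\<^bsub>(q)\<^esub> u) - b\<^bsub>(q)\<^esub> (a\<^bsub>(p)\<^esub> u) =
     (\<Sum>i<N. ((of_int p :: complex) gchoose i) \<cdot> (a\<^bsub>(int i)\<^esub> b)\<^bsub>(p + q - int i)\<^esub> u)"
proof -
  let ?g = "\<lambda>i::nat. smul V ((-1) ^ i * ((of_int 0 :: complex) gchoose i))
          (mode V a (p + 0 - int i) (mode V b (q + int i) u)
           - smul V ((-1) powi 0)
               (mode V b (q + 0 - int i) (mode V a (p + int i) u)))"
  let ?f = "\<lambda>i::nat. ((of_int p :: complex) gchoose i) \<cdot> (a\<^bsub>(0 + int i)\<^esub> b)\<^bsub>(p + q - int i)\<^esub> u"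
  have "Sum_any ?g = sum ?g {0}"
    by (rule Sum_any_eq_sum) (simp_all add: gbinomial_0_left)
  moreover have "Sum_any ?f = sum ?f {..<N}"
    by (rule Sum_any_eq_sum) (simp_all add: assms)
  ultimately show ?thesis using borcherds[of p a 0 b q u] by simp
qed

lemma commutator_vanishing:
  "(\<And>i. a\<^bsub>(int i)\<^esub> b = 0) \<Longrightarrow> a\<^bsub>(p)\<^esub> (b\<^bsub>(q)\<^esub> u) = b\<^bsub>(q)\<^esub> (a\<^bsub>(p)\<^esub> u)"
  using commutator[of 0 a b p q u] by simp

lemma commutator_nonneg:
  assumes "p \<ge> 0"
  shows "a\<^bsub>(p)\<^esub> (b\<^bsub>(q)\<^esub> u) - b\<^bsub>(q)\<^esub> (a\<^bsub>(p)\<^esub> u) =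
     (\<Sum>i\<le>nat p. (of_nat (nat p choose i) :: complex) \<cdot> (a\<^bsub>(int i)\<^esub> b)\<^bsub>(p + q - int i)\<^esub> u)"
proof -
  obtain m where m: "p = int m" using assms nonneg_int_cases by blast
  let ?g = "\<lambda>i::nat. smul V ((-1) ^ i * ((of_int 0 :: complex) gchoose i))
          (mode V a (p + 0 - int i) (mode V b (q + int i) u)
           - smul V ((-1) powi 0)
               (mode V b (q + 0 - int i) (mode V a (p + int i) u)))"
  let ?f = "\<lambda>i::nat. ((of_int p :: complex) gchoose i) \<cdot> (a\<^bsub>(0 + int i)\<^esub> b)\<^bsub>(p + q - int i)\<^esub> u"
  have "Sum_any ?g = sum ?g {0}"
    by (rule Sum_any_eq_sum) (simp_all add: gbinomial_0_left)
  moreover have "Sum_any ?f = sum ?f {..m}"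
    by (rule Sum_any_eq_sum) (simp_all add: m binomial_gbinomial[symmetric])
  ultimately show ?thesis using borcherds[of p a 0 b q u] by (simp add: m binomial_gbinomial)
qed

lemma iterate:
  assumes "\<And>i. i \<ge> N \<Longrightarrow> b\<^bsub>(q + int i)\<^esub> u = 0" "\<And>i. i \<ge> N \<Longrightarrow> a\<^bsub>(int i)\<^esub> u = 0"
  shows "(a\<^bsub>(r)\<^esub> b)\<^bsub>(q)\<^esub> u = (\<Sum>i<N. ((-1) ^ i * ((of_int r :: complex) gchoose i)) \<cdot>
     (a\<^bsub>(r - int i)\<^esub> (b\<^bsub>(q + int i)\<^esub> u) - ((-1) powi r) \<cdot> b\<^bsub>(q + r - int i)\<^esub> (a\<^bsub>(int i)\<^esub> u)))"
proof -
  let ?f = "\<lambda>i::nat. ((of_int 0 :: complex) gchoose i) \<cdot> (a\<^bsub>(r + int i)\<^esub> b)\<^bsub>(0 + q - int i)\<^esub> u"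
  let ?g = "\<lambda>i::nat. smul V ((-1) ^ i * ((of_int r :: complex) gchoose i))
          (mode V a (0 + r - int i) (mode V b (q + int i) u)
           - smul V ((-1) powi r)
               (mode V b (q + r - int i) (mode V a (0 + int i) u)))"
  have "Sum_any ?f = sum ?f {0}"
    by (rule Sum_any_eq_sum) (simp_all add: gbinomial_0_left)
  moreover have "Sum_any ?g = sum ?g {..<N}"
    by (rule Sum_any_eq_sum) (simp_all add: assms)
  ultimately show ?thesis using borcherds[of 0 a r b q u] by simp
qed

lemma iterate_minus_one:
  assumes "\<And>i. i \<ge> N \<Longrightarrow> b\<^bsub>(q + int i)\<^esub> u = 0" "\<And>i. i \<ge> N \<Longrightarrow> a\<^bsub>(int i)\<^esub> u = 0"
  shows "(a\<^bsub>(-1)\<^esub> b)\<^bsub>(q)\<^esub> u =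
    (\<Sum>i<N. a\<^bsub>(- 1 - int i)\<^esub> (b\<^bsub>(q + int i)\<^esub> u) + b\<^bsub>(q - 1 - int i)\<^esub> (a\<^bsub>(int i)\<^esub> u))"
  using iterate[of N b q u a "-1"] assms by (simp add: gbinomial_minus_one algebra_simps)

lemma truncation2: "\<exists>N::nat. (\<forall>i\<ge>N. a\<^bsub>(p + int i)\<^esub> b = 0) \<and> (\<forall>i\<ge>N. a'\<^bsub>(p' + int i)\<^esub> b' = 0)"
proof -
  obtain M M' where M: "\<And>n. n \<ge> M \<Longrightarrow> a\<^bsub>(n)\<^esub> b = 0" "\<And>n. n \<ge> M' \<Longrightarrow> a'\<^bsub>(n)\<^esub> b' = 0"
    using truncation by meson
  show ?thesis
    by (rule exI[of _ "nat (max (M - p) (M' - p'))"]) (auto intro!: M)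
qed

text \<open>
  The vacuum is the identity: \<open>\<one>\<^sub>(\<^sub>-\<^sub>1\<^sub>) a = a\<close> comes from the Borcherds identity applied to \<open>\<one>\<close>, and
  the iterate formula for \<open>\<one>\<^sub>(\<^sub>-\<^sub>1\<^sub>) \<one> = \<one>\<close> becomes \<open>\<one>\<^sub>(\<^sub>q\<^sub>) u = 2 \<one>\<^sub>(\<^sub>q\<^sub>) u\<close> for \<open>q \<le> -2\<close>, by induction.
\<close>

lemma vac_mode_minus_one: "\<one>\<^bsub>(-1)\<^esub> a = a"
proof -
  let ?f = "\<lambda>i::nat. smul V ((of_int (-1) :: complex) gchoose i)
          (mode V (mode V \<one> (-1 + int i) a) (-1 + 0 - int i) \<one>)"
  let ?g = "\<lambda>i::nat. smul V ((-1) ^ i * ((of_int (-1) :: complex) gchoose i))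
          (mode V \<one> (-1 + (-1) - int i) (mode V a (0 + int i) \<one>)
           - smul V ((-1) powi (-1))
               (mode V a (0 + (-1) - int i) (mode V \<one> (-1 + int i) \<one>)))"
  have "Sum_any ?f = sum ?f {0}"
    by (rule Sum_any_eq_sum) (simp_all add: vac_mode_nonneg)
  moreover have "Sum_any ?g = sum ?g {0}"
    by (rule Sum_any_eq_sum) (simp_all add: vac_mode_nonneg mode_vac_nonneg)
  ultimately show ?thesis using borcherds[of "-1" \<one> "-1" a 0 \<one>]
    by (simp add: creation mode_vac_nonneg)
qed

lemma vac_mode_int: "\<one>\<^bsub>(n)\<^esub> a = (if n = -1 then a else 0)"
proof -
  have "\<forall>a. \<one>\<^bsub>(- 2 - int m)\<^esub> a = 0" for m
  proof (induction m rule: less_induct)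
    case (less m)
    show ?case
    proof
      fix a
      obtain N where N: "\<forall>i\<ge>N. \<one>\<^bsub>(- 2 - int m + int i)\<^esub> a = 0" "\<forall>i\<ge>N. \<one>\<^bsub>(0 + int i)\<^esub> a = 0"
        using truncation2 by blast
      define M where "M = N + m + 2"
      have e: "- int m - 2 = - 2 - int m" by simp
      have "\<one>\<^bsub>(- 2 - int m)\<^esub> a = (\<one>\<^bsub>(-1)\<^esub> \<one>)\<^bsub>(- 2 - int m)\<^esub> a" by (simp add: creation)
      also have "\<dots> = (\<Sum>i<M. \<one>\<^bsub>(- 1 - int i)\<^esub> (\<one>\<^bsub>(- 2 - int m + int i)\<^esub> a)
          + \<one>\<^bsub>(- 2 - int m - 1 - int i)\<^esub> (\<one>\<^bsub>(int i)\<^esub> a))"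
        by (rule iterate_minus_one) (use N in \<open>simp_all add: M_def\<close>)
      also have "\<dots> = (\<Sum>i<M. \<one>\<^bsub>(- 1 - int i)\<^esub> (\<one>\<^bsub>(- 2 - int m + int i)\<^esub> a))"
        by (simp add: vac_mode_nonneg)
      also have "\<dots> = (\<Sum>i\<in>{0, m + 1}. \<one>\<^bsub>(- 1 - int i)\<^esub> (\<one>\<^bsub>(- 2 - int m + int i)\<^esub> a))"
      proof (rule sum.mono_neutral_right)
        show "\<forall>i\<in>{..<M} - {0, m + 1}. \<one>\<^bsub>(- 1 - int i)\<^esub> (\<one>\<^bsub>(- 2 - int m + int i)\<^esub> a) = 0"
        proof
          fix i assume i: "i \<in> {..<M} - {0, m + 1}"
          show "\<one>\<^bsub>(- 1 - int i)\<^esub> (\<one>\<^bsub>(- 2 - int m + int i)\<^esub> a) = 0"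
          proof (cases "i \<le> m")
            case True
            then have "- 1 - int i = - 2 - int (i - 1)" "i - 1 < m" using i by auto
            then show ?thesis using less.IH by metis
          qed (use i in \<open>simp add: vac_mode_nonneg\<close>)
        qed
      qed (auto simp: M_def)
      also have "\<dots> = \<one>\<^bsub>(- 2 - int m)\<^esub> a + \<one>\<^bsub>(- 2 - int m)\<^esub> a"
        by (simp add: vac_mode_minus_one algebra_simps flip: e)
      finally show "\<one>\<^bsub>(- 2 - int m)\<^esub> a = 0" by simp
    qed
  qed
  from this[of "nat (-2 - n)"] show ?thesis
    by (cases "n \<ge> 0"; cases "n = -1") (auto simp: vac_mode_nonneg vac_mode_minus_one)
qed

section \<open>Translation and linearity of the modes\<close>

text \<open>
  This is \<open>L\<^sub>-\<^sub>1 a\<close> in every vertex operator algebra, but what follows directly from the axioms is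
  only that the two differ by a vector killed by \<open>L\<^sub>0\<close>. For \<open>a\<^sub>(\<^sub>-\<^sub>2\<^sub>) \<one>\<close> the translation formula
  holds with all indices, by the iterate formula.
\<close>

definition transl :: "'v \<Rightarrow> 'v" where
  "transl a = a\<^bsub>(-2)\<^esub> \<one>"

lemma gbinomial_minus_two: "(- 2 :: complex) gchoose i = (- 1) ^ i * (of_nat i + 1)"
  using gbinomial_minus[of "2::complex" i] binomial_gbinomial[of "i + 1" i, where 'a = complex]
  by (simp add: add.commute)

lemma mode_transl: "(transl a)\<^bsub>(q)\<^esub> u = (- of_int q) \<cdot> a\<^bsub>(q - 1)\<^esub> u"
proof -
  obtain N where N: "\<forall>i\<ge>N. \<one>\<^bsub>(q + int i)\<^esub> u = 0" "\<forall>i\<ge>N. a\<^bsub>(0 + int i)\<^esub> u = 0"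
    using truncation2 by blast
  define M where "M = N + nat \<bar>q\<bar> + 2"
  let ?f = "\<lambda>i::nat. (of_nat i + 1 :: complex) \<cdot> a\<^bsub>(- 2 - int i)\<^esub> (\<one>\<^bsub>(q + int i)\<^esub> u)"
  let ?g = "\<lambda>i::nat. (of_nat i + 1 :: complex) \<cdot> \<one>\<^bsub>(q - 2 - int i)\<^esub> (a\<^bsub>(int i)\<^esub> u)"
  have "(transl a)\<^bsub>(q)\<^esub> u = (\<Sum>i<M. ?f i - ?g i)"
    unfolding transl_def
    by (subst iterate[of M]) (use N in \<open>auto simp: M_def gbinomial_minus_two algebra_simps\<close>)
  also have "\<dots> = sum ?f {..<M} - sum ?g {..<M}" by (rule sum_subtractf)
  also have "sum ?f {..<M} = sum ?f (if q < 0 then {nat (- 1 - q)} else {})"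
    by (rule sum.mono_neutral_right) (auto simp: M_def vac_mode_int)
  also have "sum ?g {..<M} = sum ?g (if q > 0 then {nat (q - 1)} else {})"
    by (rule sum.mono_neutral_right) (auto simp: M_def vac_mode_int)
  finally show ?thesis by (auto simp: vac_mode_int)
qed

text \<open>
  The difference \<open>z = L\<^sub>-\<^sub>1 a - a\<^sub>(\<^sub>-\<^sub>2\<^sub>) \<one>\<close> has no nonzero mode \<open>z\<^sub>(\<^sub>n\<^sub>)\<close> with \<open>n \<ge> 0\<close>. Hence \<open>z\<^sub>(\<^sub>-\<^sub>1\<^sub>)\<close>
  commutes with \<open>L\<^sub>0\<close>, and \<open>L\<^sub>0 z = L\<^sub>0 z\<^sub>(\<^sub>-\<^sub>1\<^sub>) \<one> = 0\<close>.
\<close>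

lemma transl_diff_nonneg:
  "n \<ge> 0 \<Longrightarrow> (L (-1) a - transl a)\<^bsub>(n)\<^esub> u = 0"
  using translation[of a "nat n" u] by (simp add: mode_nonneg_left mode_transl)

lemma vacuum_weight: "L 0 \<one> = 0"
  by (simp add: virasoro_def mode_vac_nonneg)

lemma virasoro_0_transl_diff: "L 0 (L (-1) a - transl a) = 0"
proof -
  let ?z = "L (-1) a - transl a"
  have "?z\<^bsub>(-1)\<^esub> (\<omega>\<^bsub>(1)\<^esub> \<one>) = \<omega>\<^bsub>(1)\<^esub> (?z\<^bsub>(-1)\<^esub> \<one>)"
    by (rule commutator_vanishing) (simp add: transl_diff_nonneg)
  then show ?thesis using vacuum_weight by (simp add: creation virasoro_def)
qed

lemma transl_virasoro_0: "transl (L 0 a) = L (-1) (L 0 a)"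
proof -
  have "\<omega>\<^bsub>(1)\<^esub> (a\<^bsub>(-2)\<^esub> \<one>) - a\<^bsub>(-2)\<^esub> (\<omega>\<^bsub>(1)\<^esub> \<one>) =
      (\<omega>\<^bsub>(0)\<^esub> a)\<^bsub>(-1)\<^esub> \<one> + (\<omega>\<^bsub>(1)\<^esub> a)\<^bsub>(-2)\<^esub> \<one>"
    using commutator_nonneg[of 1 \<omega> a "-2" \<one>] by (simp add: atMost_Suc)
  then have "L 0 (transl a) = L (-1) a + transl (L 0 a)"
    using vacuum_weight by (simp add: virasoro_def transl_def creation)
  moreover have "L 0 (L (-1) a) = L (-1) (L 0 a) + L (-1) a"
    using virasoro_bracket[of "-1" 0 a] by (simp add: algebra_simps)
  moreover have "L 0 (L (-1) a) = L 0 (transl a)"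
    using virasoro_0_transl_diff[of a] by (simp add: virasoro_def mode_nonneg_right)
  ultimately show ?thesis by simp
qed

text \<open>
  For large \<open>n\<close> the iterate formula expresses \<open>(a\<^sub>(\<^sub>r\<^sub>) w)\<^sub>(\<^sub>n\<^sub>) u\<close> by the vectors \<open>w\<^sub>(\<^sub>n\<^sub>+\<^sub>r\<^sub>-\<^sub>i\<^sub>) a\<^sub>(\<^sub>i\<^sub>) u\<close> alone. The left
  side is linear in \<open>u\<close>, because \<open>n \<ge> 0\<close>. Keeping \<open>n + r\<close> fixed and varying \<open>r\<close>, the independence
  of the binomial coefficients shows that every single \<open>w\<^sub>(\<^sub>q\<^sub>) a\<^sub>(\<^sub>i\<^sub>) u\<close> is linear in \<open>u\<close>.
\<close>

lemma mode_linear_on_image: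
  assumes "i \<ge> 0"
  shows "w\<^bsub>(q)\<^esub> (a\<^bsub>(i)\<^esub> (x \<cdot> u + y \<cdot> v)) = x \<cdot> w\<^bsub>(q)\<^esub> (a\<^bsub>(i)\<^esub> u) + y \<cdot> w\<^bsub>(q)\<^esub> (a\<^bsub>(i)\<^esub> v)"
proof -
  define defect where "defect k = w\<^bsub>(q + i - int k)\<^esub> (a\<^bsub>(int k)\<^esub> (x \<cdot> u + y \<cdot> v))
      - (x \<cdot> w\<^bsub>(q + i - int k)\<^esub> (a\<^bsub>(int k)\<^esub> u) + y \<cdot> w\<^bsub>(q + i - int k)\<^esub> (a\<^bsub>(int k)\<^esub> v))" for k :: nat
  obtain N1 where N1: "\<forall>k\<ge>N1. a\<^bsub>(0 + int k)\<^esub> u = 0" "\<forall>k\<ge>N1. w\<^bsub>(0 + int k)\<^esub> u = 0"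
    using truncation2 by blast
  obtain N2 where N2: "\<forall>k\<ge>N2. a\<^bsub>(0 + int k)\<^esub> v = 0" "\<forall>k\<ge>N2. w\<^bsub>(0 + int k)\<^esub> v = 0"
    using truncation2 by blast
  define N where "N = max N1 N2"
  have N: "a\<^bsub>(int k)\<^esub> u = 0" "a\<^bsub>(int k)\<^esub> v = 0" "w\<^bsub>(int k)\<^esub> u = 0" "w\<^bsub>(int k)\<^esub> v = 0" if "k \<ge> N" for k
    using N1 N2 that by (simp_all add: N_def)
  have N': "w\<^bsub>(n)\<^esub> u = 0" "w\<^bsub>(n)\<^esub> v = 0" if "n \<ge> int N" for n
    using N(3,4)[of "nat n"] that by simp_all
  define I where "I = N + nat i + 1"
  have "(\<Sum>k<I. ((of_int r :: complex) gchoose k) \<cdot> ((-1) ^ k \<cdot> defect k)) = 0"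
    if r: "r \<le> q + i - int N" for r
  proof -
    define n where "n = q + i - r"
    have n: "n \<ge> int N" using r by (simp add: n_def)
    have nr: "n + r - int k = q + i - int k" for k by (simp add: n_def)
    have *: "(a\<^bsub>(r)\<^esub> w)\<^bsub>(n)\<^esub> t = (- ((-1) powi r)) \<cdot>
        (\<Sum>k<I. ((of_int r :: complex) gchoose k) \<cdot> ((-1) ^ k \<cdot> w\<^bsub>(q + i - int k)\<^esub> (a\<^bsub>(int k)\<^esub> t)))"
      if "\<And>k. k \<ge> N \<Longrightarrow> a\<^bsub>(int k)\<^esub> t = 0" "\<And>n. n \<ge> int N \<Longrightarrow> w\<^bsub>(n)\<^esub> t = 0" for t
    proof -
      have "(a\<^bsub>(r)\<^esub> w)\<^bsub>(n)\<^esub> t = (\<Sum>k<I. ((-1) ^ k * ((of_int r :: complex) gchoose k)) \<cdot>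
         (a\<^bsub>(r - int k)\<^esub> (w\<^bsub>(n + int k)\<^esub> t) - ((-1) powi r) \<cdot> w\<^bsub>(n + r - int k)\<^esub> (a\<^bsub>(int k)\<^esub> t)))"
        by (rule iterate) (use that n in \<open>auto simp: I_def\<close>)
      also have "\<dots> = (- ((-1) powi r)) \<cdot>
        (\<Sum>k<I. ((of_int r :: complex) gchoose k) \<cdot> ((-1) ^ k \<cdot> w\<^bsub>(q + i - int k)\<^esub> (a\<^bsub>(int k)\<^esub> t)))"
        unfolding scale_sum_right nr
        by (rule sum.cong) (use that n in \<open>auto simp: ac_simps\<close>)
      finally show ?thesis .
    qed
    have "n \<ge> 0" using n by simp
    then have "(a\<^bsub>(r)\<^esub> w)\<^bsub>(n)\<^esub> (x \<cdot> u + y \<cdot> v) - (x \<cdot> (a\<^bsub>(r)\<^esub> w)\<^bsub>(n)\<^esub> u + y \<cdot> (a\<^bsub>(r)\<^esub> w)\<^bsub>(n)\<^esub> v) = 0"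
      by (simp add: mode_nonneg_right)
    moreover have "(a\<^bsub>(r)\<^esub> w)\<^bsub>(n)\<^esub> (x \<cdot> u + y \<cdot> v) - (x \<cdot> (a\<^bsub>(r)\<^esub> w)\<^bsub>(n)\<^esub> u + y \<cdot> (a\<^bsub>(r)\<^esub> w)\<^bsub>(n)\<^esub> v)
      = (- ((-1) powi r)) \<cdot> (\<Sum>k<I. ((of_int r :: complex) gchoose k) \<cdot> ((-1) ^ k \<cdot> defect k))"
      by (subst (1 2 3) *)
        (simp_all add: N N' mode_nonneg_right defect_def scale_right_distrib scale_right_diff_distrib
          scale_sum_right sum.distrib sum_subtractf ac_simps)
    ultimately have "(- ((-1) powi r)) \<cdot> (\<Sum>k<I. ((of_int r :: complex) gchoose k) \<cdot> ((-1) ^ k \<cdot> defect k)) = 0"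
      by simp
    then show ?thesis by simp
  qed
  then have "(-1) ^ nat i \<cdot> defect (nat i) = 0"
    by (rule gbinomial_independent) (simp_all add: I_def)
  then have "defect (nat i) = 0" by simp
  then show ?thesis using assms by (simp add: defect_def)
qed

lemmas virasoro_low = mode_nonneg_right[of "m + 1" "conf V" for m, folded virasoro_def]

lemma virasoro_zero [simp]: "L m 0 = 0"
  by (simp add: virasoro_def)

lemma virasoro_vac: "m \<ge> -1 \<Longrightarrow> L m \<one> = 0"
  by (simp add: virasoro_def mode_vac_nonneg)

lemma conf_eq: "L (-2) \<one> = \<omega>"
  by (simp add: virasoro_def creation)

lemma virasoro_conf: "m \<ge> 0 \<Longrightarrow> L m \<omega> = (if m = 0 then 2 \<cdot> \<omega> else if m = 2 then (c / 2) \<cdot> \<one> else 0)"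
  using virasoro_bracket[of "-2" "nat m" \<one>]
  by (cases "m = 1") (auto simp: conf_eq virasoro_vac)

lemma virasoro_1_translation: "L 1 (L (-1) u) = L (-1) (L 1 u) + 2 \<cdot> L 0 u"
  using virasoro_bracket[of "-1" 1 u] by (simp add: algebra_simps)

lemma mode_linear_on_range_L0:
  assumes "u \<in> range (L 0)" "v \<in> range (L 0)"
  shows "w\<^bsub>(q)\<^esub> (x \<cdot> u + y \<cdot> v) = x \<cdot> w\<^bsub>(q)\<^esub> u + y \<cdot> w\<^bsub>(q)\<^esub> v"
proof -
  obtain s t where "u = \<omega>\<^bsub>(1)\<^esub> s" "v = \<omega>\<^bsub>(1)\<^esub> t" using assms by (auto simp: virasoro_def)
  then show ?thesis using mode_linear_on_image[of 1 w q \<omega> x s y t]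
    by (simp add: mode_nonneg_right)
qed

lemma translation_range_L0:
  assumes "a \<in> range (L 0)"
  shows "(L (-1) a)\<^bsub>(q)\<^esub> u = (- of_int q) \<cdot> a\<^bsub>(q - 1)\<^esub> u"
proof -
  obtain t where "a = L 0 t" using assms by auto
  then have "L (-1) a = transl a" using transl_virasoro_0 by simp
  then show ?thesis by (simp add: mode_transl)
qed

lemma conf_range_L0: "\<omega> \<in> range (L 0)"
proof
  show "\<omega> = L 0 ((1 / 2) \<cdot> \<omega>)" by (simp add: virasoro_low virasoro_conf)
qed simp

section \<open>The weight grading\<close>

text \<open>
  Weights are indexed by integers, so that a mode shifts the weight by a fixed integer without
  truncated subtraction; the negative weight spaces turn out to be zero.
\<close>

definition weight :: "int \<Rightarrow> 'v set" where
  "weight k = {v. L 0 v = of_int k \<cdot> v}"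

lemma weight_space_weight: "weight_space V n = weight (int n)"
  by (simp add: weight_space_def weight_def)

lemma subspace_weight: "subspace (weight k)"
  by (auto simp: weight_def subspace_def virasoro_low scale_right_distrib mult.commute)

lemma weight_range_L0:
  assumes "k \<noteq> 0" "v \<in> weight k"
  shows "v \<in> range (L 0)"
proof
  show "v = L 0 ((1 / of_int k) \<cdot> v)" using assms by (simp add: weight_def virasoro_low)
qed simp

lemma weight_independent:
  assumes "finite A" "\<And>k. k \<in> A \<Longrightarrow> f k \<in> weight k" "(\<Sum>k\<in>A. f k) = 0" "k \<in> A"
  shows "f k = 0"
  using assms
proof (induction A arbitrary: f k)
  case (insert m A)
  have L0: "L 0 (f k) = of_int k \<cdot> f k" if "k \<in> insert m A" for k
    using insert.prems(1)[OF that] by (simp add: weight_def)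
  have sum: "L 0 (sum f B) = (\<Sum>k\<in>B. L 0 (f k))" if "finite B" for B
    using that by induction (simp_all add: virasoro_low)
  \<comment> \<open>applying \<open>L\<^sub>0 - m\<close> removes the component of weight \<open>m\<close>\<close>
  define f' where "f' k = (of_int (k - m) :: complex) \<cdot> f k" for k
  have "(\<Sum>k\<in>insert m A. f' k) = L 0 (\<Sum>k\<in>insert m A. f k) - of_int m \<cdot> (\<Sum>k\<in>insert m A. f k)"
    unfolding sum[OF finite.insertI[OF insert.hyps(1)]] scale_sum_right sum_subtractf[symmetric]
    by (rule sum.cong) (simp_all add: f'_def L0 scale_left_diff_distrib)
  then have "(\<Sum>k\<in>insert m A. f' k) = 0"
    by (simp only: insert.prems(2)) simp
  then have "(\<Sum>k\<in>A. f' k) = 0"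
    using insert.hyps by (simp add: f'_def)
  moreover have "f' k \<in> weight k" if "k \<in> A" for k
    using insert.prems(1)[of k] that subspace_scale[OF subspace_weight] by (simp add: f'_def)
  ultimately have "f' k = 0" if "k \<in> A" for k
    using insert.IH[of f'] that by blast
  then have A: "f k = 0" if "k \<in> A" for k
    using that insert.hyps(2) by (fastforce simp: f'_def)
  then have "f m = 0" using insert.prems(2) insert.hyps by simp
  then show ?case using A insert.prems(3) by auto
qed simp

text \<open>
  A homogeneous vector in the span of subspaces of the weight spaces lies in the one of its own
  weight. For the weight spaces themselves this shows that negative weights do not occur; for
  spans of Virasoro descendants it describes the homogeneous parts of \<open>V\<^sub>\<omega>\<close>.
\<close>

lemma homogeneous_component:
  assumes D: "\<And>n. subspace (D n)" "\<And>n. D n \<subseteq> weight (int n)"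
    and v: "v \<in> span (\<Union>n. D n)" "v \<in> weight k"
  shows "v \<in> (if k < 0 then {0} else D (nat k))"
proof -
  obtain N f where f: "\<forall>n. f n \<in> D n" "\<forall>n>N. f n = 0" "v = (\<Sum>n\<le>N. f n)"
    using span_UN_sum[OF D(1) v(1)] by blast
  define g where "g j = (if j < 0 then 0 else f (nat j)) - (if j = k then v else 0)" for j :: int
  define A where "A = insert k (int ` {..N})"
  have "(\<Sum>j\<in>A. if j < 0 then 0 else f (nat j)) = (\<Sum>j\<in>int ` {..N}. f (nat j))"
  proof (rule sum.mono_neutral_cong_right)
    show "\<forall>j\<in>A - int ` {..N}. (if j < 0 then 0 else f (nat j)) = 0"
    proof
      fix j assume j: "j \<in> A - int ` {..N}"
      have "nat j > N" if "j \<ge> 0"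
      proof (rule ccontr)
        assume "\<not> N < nat j"
        then have "j = int (nat j)" "nat j \<in> {..N}" using that by auto
        then show False using j by (metis DiffD2 imageI)
      qed
      then show "(if j < 0 then 0 else f (nat j)) = 0" using f(2) by auto
    qed
  qed (auto simp: A_def)
  also have "\<dots> = v" by (simp add: sum.reindex f(3))
  finally have "(\<Sum>j\<in>A. g j) = 0"
    by (simp add: g_def sum_subtractf A_def sum.delta)
  moreover have "g j \<in> weight j" for j
    unfolding g_def
  proof (rule subspace_diff[OF subspace_weight])
    show "(if j < 0 then 0 else f (nat j)) \<in> weight j"
      using f(1) D(2)[of "nat j"] subspace_0[OF subspace_weight[of j]] by auto
    show "(if j = k then v else 0) \<in> weight j"
      using v(2) subspace_0[OF subspace_weight[of j]] by auto
  qed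
  ultimately have "g k = 0"
    using weight_independent[of A g k] by (simp add: A_def)
  then show ?thesis using f(1) by (auto simp: g_def split: if_splits)
qed

lemma weight_negative: "k < 0 \<Longrightarrow> weight k = {0}"
  using homogeneous_component[of "\<lambda>n. weight (int n)" _ k] grading subspace_weight
    subspace_0[OF subspace_weight, of k]
  by (auto simp: weight_space_weight)

lemma fin_dim_weight: "fin_dim_subspace (weight (int n))"
  using weight_space_finite[of n] subspace_weight
  by (auto simp: fin_dim_subspace_def weight_space_weight)

lemma vac_weight: "\<one> \<in> weight 0"
  by (simp add: weight_def virasoro_vac)

lemma conf_weight: "\<omega> \<in> weight 2"
  by (simp add: weight_def virasoro_conf)

end

locale griess_voa = vertex_operator_algebra V c for V :: "('v::ab_group_add) voa_data" and c +
  assumes weight_space_0: "weight_space V 0 = module.span (smul V) {vac V}"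
    and weight_space_1: "weight_space V 1 = {0}"
    and rank_nonzero: "c \<noteq> 0"
begin

lemma weight_0: "weight 0 = range (\<lambda>x. x \<cdot> \<one>)"
  using weight_space_0 by (simp add: weight_space_weight span_singleton)

lemma weight_1: "weight 1 = {0}"
  using weight_space_1 by (simp add: weight_space_weight)

lemma conf_nonzero: "\<omega> \<noteq> 0"
  using virasoro_conf[of 2] rank_nonzero vac_nonzero by auto

section \<open>Scalar multiples of the vacuum act as scalars\<close>

text \<open>Since \<open>\<one>\<close> is a multiple of \<open>L\<^sub>2 \<omega>\<close>, the modes are linear on multiples of \<open>\<one>\<close>.\<close>

lemma mode_scaled_vac: "w\<^bsub>(q)\<^esub> (x \<cdot> \<one>) = x \<cdot> w\<^bsub>(q)\<^esub> \<one>"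
proof -
  have *: "\<omega>\<^bsub>(3)\<^esub> \<omega> = (c / 2) \<cdot> \<one>" using virasoro_conf[of 2] by (simp add: virasoro_def)
  have image: "w\<^bsub>(q)\<^esub> (y \<cdot> \<one>) = (2 * y / c) \<cdot> w\<^bsub>(q)\<^esub> (\<omega>\<^bsub>(3)\<^esub> \<omega>)" for y
  proof -
    have "\<omega>\<^bsub>(3)\<^esub> ((2 * y / c) \<cdot> \<omega> + 0 \<cdot> 0) = y \<cdot> \<one>"
      using rank_nonzero by (simp add: mode_nonneg_right *)
    then show ?thesis
      using mode_linear_on_image[of 3 w q \<omega> "2 * y / c" \<omega> 0 0] by simp
  qed
  have "w\<^bsub>(q)\<^esub> \<one> = (2 / c) \<cdot> w\<^bsub>(q)\<^esub> (\<omega>\<^bsub>(3)\<^esub> \<omega>)" using image[of 1] by simp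
  then have "x \<cdot> w\<^bsub>(q)\<^esub> \<one> = (x * (2 / c)) \<cdot> w\<^bsub>(q)\<^esub> (\<omega>\<^bsub>(3)\<^esub> \<omega>)" by (metis scale_scale)
  also have "x * (2 / c) = 2 * x / c" by simp
  finally show ?thesis by (simp only: image)
qed

text \<open>
  For \<open>a = x \<one>\<close> the vector \<open>a\<^sub>(\<^sub>-\<^sub>2\<^sub>) \<one>\<close> has weight \<open>0\<close>, so it is a multiple \<open>\<delta> \<one>\<close>, and comparing
  \<open>(x \<omega>)\<^sub>(\<^sub>-\<^sub>2\<^sub>) \<one>\<close> with \<open>x \<omega>\<^sub>(\<^sub>-\<^sub>2\<^sub>) \<one>\<close> gives \<open>\<delta> \<omega> = 0\<close>.
\<close>

lemma scaled_vac_mode: "(x \<cdot> \<one>)\<^bsub>(n)\<^esub> b = (if n = -1 then x \<cdot> b else 0)"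
proof -
  let ?x = "x \<cdot> \<one>"
  have nonneg: "?x\<^bsub>(m)\<^esub> u = 0" if "m \<ge> 0" for m u
    using that by (simp add: mode_nonneg_left vac_mode_nonneg)
  have central: "?x\<^bsub>(p)\<^esub> u = u\<^bsub>(-1)\<^esub> (?x\<^bsub>(p)\<^esub> \<one>)" for p u
    using commutator_vanishing[of ?x u p "-1" \<one>] by (simp add: nonneg creation)
  have one: "?x\<^bsub>(-1)\<^esub> u = x \<cdot> u" for u
    using central[of "-1" u] by (simp add: creation mode_scaled_vac)
  have "L (-1) ?x = 0" by (simp add: virasoro_low virasoro_vac)
  then have "L 0 0 - L 0 (transl ?x) = 0"
    using virasoro_0_transl_diff[of ?x] virasoro_low(3)[of 0 0 "transl ?x"] by (simp only:)
  then have "L 0 (transl ?x) = 0" by simp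
  then have "transl ?x \<in> weight 0" by (simp add: weight_def)
  then obtain \<delta> where \<delta>: "transl ?x = \<delta> \<cdot> \<one>" by (auto simp: weight_0)
  then have two: "?x\<^bsub>(-2)\<^esub> u = \<delta> \<cdot> u" for u
    using central[of "-2" u] by (simp add: transl_def creation mode_scaled_vac)
  have T: "transl (t \<cdot> \<omega>) = t \<cdot> transl \<omega>" for t
  proof -
    have *: "t \<cdot> \<omega> = L 0 ((t / 2) \<cdot> \<omega>)" for t by (simp add: virasoro_low virasoro_conf)
    have "transl (t \<cdot> \<omega>) = L (-1) (t \<cdot> \<omega>)" for t
      using transl_virasoro_0[of "(t / 2) \<cdot> \<omega>"] by (simp only: *[of t, symmetric])
    from this[of t] this[of 1] show ?thesis by (simp add: virasoro_low)
  qed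
  have "transl (x \<cdot> \<omega>) = (?x\<^bsub>(-1)\<^esub> \<omega>)\<^bsub>(-2)\<^esub> \<one>" by (simp add: one transl_def)
  also have "\<dots> = (\<Sum>i<2. ?x\<^bsub>(- 1 - int i)\<^esub> (\<omega>\<^bsub>(- 2 + int i)\<^esub> \<one>) + \<omega>\<^bsub>(- 2 - 1 - int i)\<^esub> (?x\<^bsub>(int i)\<^esub> \<one>))"
    by (rule iterate_minus_one) (simp_all add: mode_vac_nonneg)
  also have "\<dots> = x \<cdot> transl \<omega> + \<delta> \<cdot> \<omega>"
    by (simp add: numeral_2_eq_2 nonneg one two transl_def creation)
  finally have "\<delta> = 0" using conf_nonzero T by simp
  then have "transl ?x = 0" by (simp add: \<delta>)
  have neg: "?x\<^bsub>(- 2 - int m)\<^esub> u = 0" for m u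
  proof -
    have e: "- 1 - int m - 1 = - 2 - int m" by simp
    have "(- of_int (- 1 - int m) :: complex) \<cdot> ?x\<^bsub>(- 2 - int m)\<^esub> u = 0"
      using mode_transl[of ?x "- 1 - int m" u, unfolded e] \<open>transl ?x = 0\<close> by (simp only: mode_zero)
    moreover have "(- of_int (- 1 - int m) :: complex) = of_nat (Suc m)" by simp
    ultimately show ?thesis by (simp only: scale_eq_0_iff of_nat_eq_0_iff nat.simps simp_thms)
  qed
  from neg[of "nat (- 2 - n)"] show ?thesis
    by (cases "n \<ge> 0"; cases "n = -1") (auto simp: nonneg one)
qed

lemma mode_scale_left: "(x \<cdot> a)\<^bsub>(q)\<^esub> u = x \<cdot> a\<^bsub>(q)\<^esub> u"
proof -
  obtain N where N: "\<forall>i\<ge>N. a\<^bsub>(q + int i)\<^esub> u = 0" "\<forall>i\<ge>N. \<one>\<^bsub>(0 + int i)\<^esub> u = 0"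
    using truncation2 by blast
  have "(x \<cdot> a)\<^bsub>(q)\<^esub> u = ((x \<cdot> \<one>)\<^bsub>(-1)\<^esub> a)\<^bsub>(q)\<^esub> u" by (simp add: scaled_vac_mode)
  also have "\<dots> = (\<Sum>i<Suc N. (x \<cdot> \<one>)\<^bsub>(- 1 - int i)\<^esub> (a\<^bsub>(q + int i)\<^esub> u)
      + a\<^bsub>(q - 1 - int i)\<^esub> ((x \<cdot> \<one>)\<^bsub>(int i)\<^esub> u))"
    by (rule iterate_minus_one) (use N in \<open>simp_all add: scaled_vac_mode\<close>)
  also have "\<dots> = x \<cdot> a\<^bsub>(q)\<^esub> u"
    by (simp add: scaled_vac_mode sum.lessThan_Suc_shift del: sum.lessThan_Suc)
  finally show ?thesis .
qed

lemma mode_scale_right: "a\<^bsub>(q)\<^esub> (x \<cdot> u) = x \<cdot> a\<^bsub>(q)\<^esub> u"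
  using commutator_vanishing[of "x \<cdot> \<one>" a "-1" q u] by (simp add: scaled_vac_mode)

lemma linear_on_weight: "linear_on (weight k) (mode V w q)"
proof (cases "k = 0")
  case True
  then show ?thesis
    by (auto simp: linear_on_def weight_0 mode_scaled_vac scale_left_distrib[symmetric])
next
  case False
  then show ?thesis
    using mode_linear_on_range_L0 weight_range_L0 by (auto simp: linear_on_def)
qed

lemma weight_mode:
  assumes "j \<noteq> 0" and a: "a \<in> weight j" and b: "b \<in> weight k"
  shows "a\<^bsub>(n)\<^esub> b \<in> weight (j + k - n - 1)"
proof -
  have "L 0 (a\<^bsub>(n)\<^esub> b) - a\<^bsub>(n)\<^esub> (L 0 b) = (L (-1) a)\<^bsub>(n + 1)\<^esub> b + (L 0 a)\<^bsub>(n)\<^esub> b"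
    using commutator_nonneg[of 1 \<omega> a n b] by (simp add: virasoro_def atMost_Suc algebra_simps)
  also have "(L (-1) a)\<^bsub>(n + 1)\<^esub> b = (- of_int (n + 1)) \<cdot> a\<^bsub>(n)\<^esub> b"
    using translation_range_L0[OF weight_range_L0[OF assms(1) a], of "n + 1" b] by simp
  also have "(L 0 a)\<^bsub>(n)\<^esub> b = of_int j \<cdot> a\<^bsub>(n)\<^esub> b"
    using a by (simp add: weight_def mode_scale_left)
  finally have "L 0 (a\<^bsub>(n)\<^esub> b) = of_int k \<cdot> a\<^bsub>(n)\<^esub> b + ((- of_int (n + 1)) \<cdot> a\<^bsub>(n)\<^esub> b + of_int j \<cdot> a\<^bsub>(n)\<^esub> b)"
    using b by (simp add: weight_def mode_scale_right algebra_simps)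
  also have "\<dots> = of_int (j + k - n - 1) \<cdot> a\<^bsub>(n)\<^esub> b"
    by (simp only: scale_left_distrib[symmetric]) (simp add: algebra_simps)
  finally show ?thesis by (simp add: weight_def)
qed

lemma virasoro_weight: "v \<in> weight k \<Longrightarrow> L m v \<in> weight (k - m)"
  using weight_mode[OF _ conf_weight, of v k "m + 1"] by (simp add: virasoro_def algebra_simps)

section \<open>Linearity of the Virasoro operators\<close>

lemma vac_plus_range_L0: "\<exists>y v. u = y \<cdot> \<one> + L 0 v"
proof -
  have "u \<in> span (\<Union>n. weight_space V n)" using grading by simp
  then show ?thesis
  proof (induction rule: span_induct_alt)
    case base
    show ?case by (rule exI[of _ 0], rule exI[of _ 0]) simp
  next
    case (step z x t)
    then obtain y v n where t: "t = y \<cdot> \<one> + L 0 v" and x: "x \<in> weight (int n)"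
      by (auto simp: weight_space_weight)
    show ?case
    proof (cases "n = 0")
      case True
      then obtain x' where "x = x' \<cdot> \<one>" using x by (auto simp: weight_0)
      then have "z \<cdot> x + t = (z * x' + y) \<cdot> \<one> + L 0 v" by (simp add: t scale_left_distrib)
      then show ?thesis by blast
    next
      case False
      then obtain s where "x = L 0 s" using weight_range_L0[of "int n" x] x by auto
      then have "z \<cdot> x + t = y \<cdot> \<one> + L 0 (z \<cdot> s + v)" by (simp add: t virasoro_low)
      then show ?thesis by blast
    qed
  qed
qed

text \<open>
  It remains to see that \<open>\<omega>\<^sub>(\<^sub>-\<^sub>1\<^sub>)\<close> is additive on sums \<open>y \<one> + v\<close> with \<open>v\<close> in the range of \<open>L\<^sub>0\<close>. The
  defect \<open>\<eta>\<close> is a primary vector of weight \<open>2\<close>, on which \<open>(\<omega>\<^sub>(\<^sub>-\<^sub>1\<^sub>) \<omega>)\<^sub>(\<^sub>3\<^sub>)\<close> acts by \<open>8\<close>. On the other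
  hand this operator acts on \<open>\<eta>\<close> by the same scalar \<open>c + 8\<close> as on \<open>\<omega>\<close>.
\<close>

lemma conf_square_mode_3:
  assumes "u \<in> weight 2" "L 1 u = 0" "L 2 u = s \<cdot> \<one>" "\<And>m. m \<ge> 3 \<Longrightarrow> L m u = 0"
  shows "(\<omega>\<^bsub>(-1)\<^esub> \<omega>)\<^bsub>(3)\<^esub> u = (2 * s) \<cdot> \<omega> + 8 \<cdot> u"
proof -
  have w: "\<omega>\<^bsub>(0)\<^esub> u = L (-1) u" "\<omega>\<^bsub>(1)\<^esub> u = 2 \<cdot> u" "\<omega>\<^bsub>(2)\<^esub> u = 0" "\<omega>\<^bsub>(3)\<^esub> u = s \<cdot> \<one>"
    using assms(1-3) by (simp_all add: virasoro_def weight_def)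
  have w4: "\<omega>\<^bsub>(m)\<^esub> u = 0" if "m \<ge> 4" for m
    using assms(4)[of "m - 1"] that by (simp add: virasoro_def)
  have "\<omega>\<^bsub>(2)\<^esub> (L (-1) u) = 4 \<cdot> u"
    using virasoro_1_translation[of u] assms(1,2) by (simp add: virasoro_def weight_def)
  moreover have "(\<omega>\<^bsub>(-1)\<^esub> \<omega>)\<^bsub>(3)\<^esub> u =
      (\<Sum>i<4. \<omega>\<^bsub>(- 1 - int i)\<^esub> (\<omega>\<^bsub>(3 + int i)\<^esub> u) + \<omega>\<^bsub>(3 - 1 - int i)\<^esub> (\<omega>\<^bsub>(int i)\<^esub> u))"
    by (rule iterate_minus_one) (simp_all add: w4)
  moreover have "4 \<cdot> u + (s \<cdot> \<omega> + (4 \<cdot> u + s \<cdot> \<omega>)) = (2 * s) \<cdot> \<omega> + 8 \<cdot> u"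
    by (simp add: scale_left_distrib[symmetric] algebra_simps flip: scale_left_distrib)
  ultimately show ?thesis
    by (simp add: eval_nat_numeral w w4 mode_scale_right creation algebra_simps)
qed

lemma conf_mode_vac_plus:
  assumes v: "v \<in> range (L 0)"
  shows "\<omega>\<^bsub>(-1)\<^esub> (y \<cdot> \<one> + v) = y \<cdot> \<omega> + \<omega>\<^bsub>(-1)\<^esub> v"
proof -
  define b where "b = y \<cdot> \<one> + v"
  define \<eta> where "\<eta> = \<omega>\<^bsub>(-1)\<^esub> b - \<omega>\<^bsub>(-1)\<^esub> v - y \<cdot> \<omega>"
  have same: "w\<^bsub>(n)\<^esub> b = w\<^bsub>(n)\<^esub> v" if "n \<ge> 0" for w n
    using that by (simp add: b_def mode_nonneg_right mode_vac_nonneg)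
  \<comment> \<open>in the commutator of \<open>\<beta>\<^sub>(\<^sub>n\<^sub>)\<close> and \<open>\<omega>\<^sub>(\<^sub>-\<^sub>1\<^sub>)\<close> only the last term has a negative mode\<close>
  have eta: "\<beta>\<^bsub>(n)\<^esub> \<eta> = (\<beta>\<^bsub>(n)\<^esub> \<omega>)\<^bsub>(-1)\<^esub> b - (\<beta>\<^bsub>(n)\<^esub> \<omega>)\<^bsub>(-1)\<^esub> v - y \<cdot> \<beta>\<^bsub>(n)\<^esub> \<omega>"
    if "n \<ge> 0" for \<beta> n
  proof -
    obtain k where k: "n = int k" using \<open>n \<ge> 0\<close> nonneg_int_cases by blast
    let ?S = "\<lambda>u i. (of_nat (k choose i) :: complex) \<cdot> (\<beta>\<^bsub>(int i)\<^esub> \<omega>)\<^bsub>(int k - 1 - int i)\<^esub> u"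
    have comm: "\<beta>\<^bsub>(n)\<^esub> (\<omega>\<^bsub>(-1)\<^esub> u) = \<omega>\<^bsub>(-1)\<^esub> (\<beta>\<^bsub>(n)\<^esub> u) + ((\<Sum>i<k. ?S u i) + (\<beta>\<^bsub>(n)\<^esub> \<omega>)\<^bsub>(-1)\<^esub> u)" for u
      using commutator_nonneg[of n \<beta> \<omega> "-1" u] \<open>n \<ge> 0\<close>
      by (simp add: k algebra_simps flip: lessThan_Suc_atMost)
    have "(\<Sum>i<k. ?S b i) = (\<Sum>i<k. ?S v i)"
      by (rule sum.cong) (simp_all add: same)
    then show ?thesis
      using comm[of b] comm[of v] same[OF \<open>n \<ge> 0\<close>, of \<beta>] \<open>n \<ge> 0\<close>
      by (simp add: \<eta>_def mode_nonneg_right)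
  qed
  have eta_scalar: "\<beta>\<^bsub>(n)\<^esub> \<eta> = z \<cdot> \<eta>" if "n \<ge> 0" "\<beta>\<^bsub>(n)\<^esub> \<omega> = z \<cdot> \<omega>" for \<beta> n z
    using that eta[of n \<beta>] by (simp add: mode_scale_left \<eta>_def scale_right_diff_distrib mult.commute)
  have w: "\<omega>\<^bsub>(n + 1)\<^esub> \<omega> = (if n = 0 then 2 \<cdot> \<omega> else if n = 2 then (c / 2) \<cdot> \<one> else 0)" if "n \<ge> 0" for n
    using virasoro_conf[OF that] by (simp add: virasoro_def)
  have L0: "\<eta> \<in> weight 2"
    using eta_scalar[of 1 \<omega> 2] w[of 0] by (simp add: weight_def virasoro_def)
  have L1: "L 1 \<eta> = 0" using eta_scalar[of 2 \<omega> 0] w[of 1] by (simp add: virasoro_def)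
  have L2: "L 2 \<eta> = 0 \<cdot> \<one>"
    using eta[of 3 \<omega>] w[of 2] by (simp add: virasoro_def scaled_vac_mode b_def scale_right_distrib mult.commute)
  have L3: "L m \<eta> = 0" if "m \<ge> 3" for m
    using eta_scalar[of "m + 1" \<omega> 0] w[of m] that by (simp add: virasoro_def)
  \<comment> \<open>\<open>\<eta>\<close> gets the eigenvalue \<open>c + 8\<close> of \<open>\<omega>\<close>, but as a primary vector it has eigenvalue \<open>8\<close>\<close>
  have "(\<omega>\<^bsub>(-1)\<^esub> \<omega>)\<^bsub>(3)\<^esub> \<omega> = (2 * (c / 2)) \<cdot> \<omega> + 8 \<cdot> \<omega>"
    by (rule conf_square_mode_3) (simp_all add: conf_weight virasoro_conf)
  then have "(\<omega>\<^bsub>(-1)\<^esub> \<omega>)\<^bsub>(3)\<^esub> \<eta> = (c + 8) \<cdot> \<eta>"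
    by (intro eta_scalar) (simp_all add: scale_left_distrib)
  then have "c \<cdot> \<eta> = 0"
    using conf_square_mode_3[OF L0 L1 L2 L3] by (simp add: scale_left_distrib)
  then have "\<eta> = 0" using rank_nonzero by simp
  then show ?thesis by (simp add: \<eta>_def b_def algebra_simps)
qed

text \<open>The remaining negative modes of \<open>\<omega>\<close> are iterated commutators of \<open>\<omega>\<^sub>(\<^sub>-\<^sub>1\<^sub>)\<close> with \<open>L\<^sub>-\<^sub>1\<close>.\<close>

lemma virasoro_linear: "L m (x \<cdot> u + x' \<cdot> u') = x \<cdot> L m u + x' \<cdot> L m u'"
proof -
  have one: "\<omega>\<^bsub>(-1)\<^esub> (x \<cdot> u + x' \<cdot> u') = x \<cdot> \<omega>\<^bsub>(-1)\<^esub> u + x' \<cdot> \<omega>\<^bsub>(-1)\<^esub> u'" for x x' u u'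
  proof -
    obtain y v y' v' where u: "u = y \<cdot> \<one> + L 0 v" "u' = y' \<cdot> \<one> + L 0 v'"
      using vac_plus_range_L0 by meson
    have r: "x \<cdot> u + x' \<cdot> u' = (x * y + x' * y') \<cdot> \<one> + (x \<cdot> L 0 v + x' \<cdot> L 0 v')"
      by (simp add: u scale_right_distrib scale_left_distrib algebra_simps)
    have "x \<cdot> L 0 v + x' \<cdot> L 0 v' = L 0 (x \<cdot> v + x' \<cdot> v')" by (simp add: virasoro_low)
    then have rng: "x \<cdot> L 0 v + x' \<cdot> L 0 v' \<in> range (L 0)" by (metis rangeI)
    have "\<omega>\<^bsub>(-1)\<^esub> (x \<cdot> u + x' \<cdot> u') =
        (x * y + x' * y') \<cdot> \<omega> + \<omega>\<^bsub>(-1)\<^esub> (x \<cdot> L 0 v + x' \<cdot> L 0 v')"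
      unfolding r by (rule conf_mode_vac_plus[OF rng])
    also have "\<omega>\<^bsub>(-1)\<^esub> (x \<cdot> L 0 v + x' \<cdot> L 0 v') = x \<cdot> \<omega>\<^bsub>(-1)\<^esub> (L 0 v) + x' \<cdot> \<omega>\<^bsub>(-1)\<^esub> (L 0 v')"
      by (rule mode_linear_on_range_L0) auto
    moreover have "\<omega>\<^bsub>(-1)\<^esub> u = y \<cdot> \<omega> + \<omega>\<^bsub>(-1)\<^esub> (L 0 v)" "\<omega>\<^bsub>(-1)\<^esub> u' = y' \<cdot> \<omega> + \<omega>\<^bsub>(-1)\<^esub> (L 0 v')"
      unfolding u by (rule conf_mode_vac_plus, simp)+
    ultimately show ?thesis
      by (simp only: scale_right_distrib scale_left_distrib scale_scale add_ac)
  qed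
  have "\<omega>\<^bsub>(- 1 - int n)\<^esub> (x \<cdot> u + x' \<cdot> u') = x \<cdot> \<omega>\<^bsub>(- 1 - int n)\<^esub> u + x' \<cdot> \<omega>\<^bsub>(- 1 - int n)\<^esub> u'" for n x x' u u'
  proof (induction n arbitrary: x x' u u')
    case 0
    then show ?case using one by simp
  next
    case (Suc n)
    let ?q = "- 1 - int n"
    have q: "\<omega>\<^bsub>(- 1 - int (Suc n))\<^esub> t = (1 / of_nat (Suc n)) \<cdot> (\<omega>\<^bsub>(0)\<^esub> (\<omega>\<^bsub>(?q)\<^esub> t) - \<omega>\<^bsub>(?q)\<^esub> (\<omega>\<^bsub>(0)\<^esub> t))" for t
    proof -
      have "\<omega>\<^bsub>(0)\<^esub> (\<omega>\<^bsub>(?q)\<^esub> t) - \<omega>\<^bsub>(?q)\<^esub> (\<omega>\<^bsub>(0)\<^esub> t) = (L (-1) \<omega>)\<^bsub>(?q)\<^esub> t"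
        using commutator_nonneg[of 0 \<omega> \<omega> ?q t] by (simp add: virasoro_def)
      also have "\<dots> = of_nat (Suc n) \<cdot> \<omega>\<^bsub>(- 1 - int (Suc n))\<^esub> t"
        unfolding translation_range_L0[OF conf_range_L0] by (simp add: algebra_simps)
      finally show ?thesis by (simp del: of_nat_Suc)
    qed
    show ?case
      unfolding q by (simp add: Suc mode_nonneg_right algebra_simps)
  qed
  from this[of "nat (- 2 - m)"] show ?thesis
    by (cases "m \<ge> -1") (simp_all add: virasoro_def mode_nonneg_right add.commute[of 1 m])
qed

section \<open>The Virasoro submodule in low weights\<close>

inductive descendant :: "nat \<Rightarrow> 'v \<Rightarrow> bool" where
  vac: "descendant 0 \<one>"
| step: "descendant n w \<Longrightarrow> m > 0 \<Longrightarrow> descendant (n + m) (L (- int m) w)"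

lemma virasoro_span:
  assumes "\<And>w. w \<in> A \<Longrightarrow> L m w \<in> span B" "w \<in> span A"
  shows "L m w \<in> span B"
  using assms(2)
proof (induction rule: span_induct_alt)
  case base
  show ?case by (simp add: span_zero)
next
  case (step z x y)
  then have "z \<cdot> L m x + 1 \<cdot> L m y \<in> span B"
    using assms(1) by (intro span_add span_scale) auto
  then show ?case using virasoro_linear[of m z x 1 y] by simp
qed

lemma diff_swap: "x - y = z \<Longrightarrow> y = x - z" for x y z :: 'v
  by auto

text \<open>
  An operator \<open>L\<^sub>m\<close> with \<open>m \<ge> 0\<close> moves past \<open>L\<^sub>-\<^sub>k\<close> at the cost of vectors \<open>L\<^sub>j w\<close> with a shorter word \<open>w\<close>, so the
  words in the \<open>L\<^sub>-\<^sub>k\<close>, \<open>k > 0\<close>, already span a submodule.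
\<close>

lemma virasoro_descendant:
  assumes "descendant n w"
  shows "L m w \<in> span {w. \<exists>n. descendant n w}" (is "_ \<in> span ?D")
  using assms
proof (induction arbitrary: m)
  case vac
  show ?case
  proof (cases "m \<ge> -1")
    case True
    then show ?thesis by (simp add: virasoro_vac span_zero)
  next
    case False
    then have "descendant (0 + nat (- m)) (L (- int (nat (- m))) \<one>)"
      by (intro descendant.intros) auto
    then have "L m \<one> \<in> ?D" using False by auto
    then show ?thesis by (rule span_base)
  qed
next
  case (step n w k)
  have neg: "L (- int j) u \<in> span ?D" if "u \<in> span ?D" "j > 0" for u j
  proof (rule virasoro_span[OF _ that(1)])
    fix w' assume "w' \<in> ?D"
    then obtain n' where "descendant n' w'" by blast
    then have "L (- int j) w' \<in> ?D" using descendant.step that(2) by blast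
    then show "L (- int j) w' \<in> span ?D" by (rule span_base)
  qed
  show ?case
  proof (cases "m \<ge> 0")
    case True
    have "L (- int k) (L m w) - L m (L (- int k) w) = of_int (- int k - m) \<cdot> L (- int k + m) w
        + (if - int k + m = 0 then of_int ((- int k) ^ 3 - (- int k)) / 12 * c else 0) \<cdot> w"
      using virasoro_bracket[of "- int k" "nat m" w] True by simp
    then have "L m (L (- int k) w) = L (- int k) (L m w) - (of_int (- int k - m) \<cdot> L (- int k + m) w
        + (if - int k + m = 0 then of_int ((- int k) ^ 3 - (- int k)) / 12 * c else 0) \<cdot> w)"
      by (rule diff_swap)
    also have "\<dots> \<in> span ?D"
    proof (intro span_diff span_add span_scale)
      show "L (- int k) (L m w) \<in> span ?D" using neg step.IH step.hyps(2) by blast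
      show "L (- int k + m) w \<in> span ?D" by (rule step.IH)
      show "w \<in> span ?D" using step.hyps(1) by (intro span_base CollectI exI)
    qed
    finally show ?thesis .
  next
    case False
    have "L (- int k) w \<in> ?D" using descendant.step[OF step.hyps] by blast
    then have "L (- int k) w \<in> span ?D" by (rule span_base)
    then show ?thesis using neg[of "L (- int k) w" "nat (- m)"] False by simp
  qed
qed

lemma virasoro_submodule_descendants: "virasoro_submodule V \<subseteq> span {w. \<exists>n. descendant n w}"
  unfolding virasoro_submodule_def
proof (rule hull_minimal)
  show "{\<one>} \<subseteq> span {w. \<exists>n. descendant n w}"
    using span_base[of \<one> "{w. \<exists>n. descendant n w}"] descendant.vac by blast
  show "subspace (span {w. \<exists>n. descendant n w}) \<and>
      (\<forall>m. \<forall>w\<in>span {w. \<exists>n. descendant n w}. L m w \<in> span {w. \<exists>n. descendant n w})"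
  proof (intro conjI allI ballI)
    fix m w assume "w \<in> span {w. \<exists>n. descendant n w}"
    then show "L m w \<in> span {w. \<exists>n. descendant n w}"
      by (rule virasoro_span[rotated]) (auto intro: virasoro_descendant)
  qed (rule subspace_span)
qed

lemma descendant_weight: "descendant n w \<Longrightarrow> w \<in> weight (int n)"
proof (induction rule: descendant.induct)
  case (step n w m)
  then show ?case using virasoro_weight[of w "int n" "- int m"] by simp
qed (simp add: vac_weight)

lemma virasoro_submodule_homogeneous:
  assumes "v \<in> virasoro_submodule V" "v \<in> weight (int k)"
  shows "v \<in> span {w. descendant k w}"
proof -
  have "v \<in> span {w. \<exists>n. descendant n w}" using assms(1) virasoro_submodule_descendants by blast
  also have "\<dots> \<subseteq> span (\<Union>n. span {w. descendant n w})"
    by (rule span_mono) (use span_base in blast)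
  finally have "v \<in> span (\<Union>n. span {w. descendant n w})" .
  moreover have "span {w. descendant n w} \<subseteq> weight (int n)" for n
    by (rule span_minimal) (auto simp: descendant_weight subspace_weight)
  ultimately show ?thesis
    using homogeneous_component[of "\<lambda>n. span {w. descendant n w}" v "int k"] assms(2)
    by auto
qed

lemma translation_conf: "L (-1) \<omega> = L (-3) \<one>"
  using translation_range_L0[OF conf_range_L0, of "-1" \<one>] by (simp add: creation virasoro_def)

lemma translation_virasoro_3: "L (-1) (L (-3) \<one>) = 2 \<cdot> L (-4) \<one>"
  using commutator_nonneg[of 0 \<omega> \<omega> "-2" \<one>] translation_range_L0[OF conf_range_L0, of "-2" \<one>]
  by (simp add: virasoro_def mode_vac_nonneg)

lemma virasoro_scale: "L m (x \<cdot> u) = x \<cdot> L m u"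
  using virasoro_linear[of m x u 0 0] by simp

lemma virasoro_add: "L m (u + v) = L m u + L m v"
  using virasoro_linear[of m 1 u 1 v] by simp

text \<open>
  As \<open>L\<^sub>-\<^sub>1 \<one> = 0\<close>, nothing is left in degree \<open>1\<close>; the other words of degree at most \<open>4\<close> are
  reduced with \<open>L\<^sub>-\<^sub>1 \<omega> = L\<^sub>-\<^sub>3 \<one>\<close> and \<open>L\<^sub>-\<^sub>1 L\<^sub>-\<^sub>3 \<one> = 2 L\<^sub>-\<^sub>4 \<one>\<close>.
\<close>

lemma descendant_low:
  assumes "descendant n w"
  shows "(n = 0 \<longrightarrow> w = \<one>) \<and> (n = 1 \<longrightarrow> w = 0) \<and> (n = 2 \<longrightarrow> (\<exists>x. w = x \<cdot> \<omega>)) \<and>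
    (n = 3 \<longrightarrow> (\<exists>x. w = x \<cdot> L (-3) \<one>)) \<and>
    (n = 4 \<longrightarrow> (\<exists>x y. w = x \<cdot> L (-2) \<omega> + y \<cdot> L (-4) \<one>))"
  using assms
proof induction
  case (step n w m)
  have "n + m > 4 \<or> n = 0 \<and> m = 1 \<or> n = 0 \<and> m = 2 \<or> n = 1 \<and> m = 1 \<or> n = 0 \<and> m = 3 \<or>
      n = 1 \<and> m = 2 \<or> n = 2 \<and> m = 1 \<or> n = 0 \<and> m = 4 \<or> n = 1 \<and> m = 3 \<or>
      n = 2 \<and> m = 2 \<or> n = 3 \<and> m = 1"
    using step.hyps(2) by arith
  then consider "n + m > 4" | "n = 0" "m = 1" | "n = 0" "m = 2" | "n = 1" "m = 1"
    | "n = 0" "m = 3" | "n = 1" "m = 2" | "n = 2" "m = 1"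
    | "n = 0" "m = 4" | "n = 1" "m = 3" | "n = 2" "m = 2" | "n = 3" "m = 1"
    by blast
  then show ?case
  proof cases
    case 1
    then show ?thesis by auto
  next
    case 2
    then show ?thesis using step by (simp add: virasoro_vac)
  next
    case 3
    then have "L (- int m) w = 1 \<cdot> \<omega>" using step by (simp add: conf_eq)
    then have "\<exists>x. L (- int m) w = x \<cdot> \<omega>" by blast
    then show ?thesis using 3 by simp
  next
    case 4
    then have "L (- int m) w = 0 \<cdot> \<omega>" using step by simp
    then have "\<exists>x. L (- int m) w = x \<cdot> \<omega>" by blast
    then show ?thesis using 4 by simp
  next
    case 5
    then have "L (- int m) w = 1 \<cdot> L (-3) \<one>" using step by simp
    then have "\<exists>x. L (- int m) w = x \<cdot> L (-3) \<one>" by blast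
    then show ?thesis using 5 by simp
  next
    case 6
    then have "L (- int m) w = 0 \<cdot> L (-3) \<one>" using step by simp
    then have "\<exists>x. L (- int m) w = x \<cdot> L (-3) \<one>" by blast
    then show ?thesis using 6 by simp
  next
    case 7
    then obtain x where "w = x \<cdot> \<omega>" using step by auto
    then have "L (- int m) w = x \<cdot> L (-3) \<one>" using 7 by (simp add: virasoro_scale translation_conf)
    then have "\<exists>x. L (- int m) w = x \<cdot> L (-3) \<one>" by blast
    then show ?thesis using 7 by simp
  next
    case 8
    then have "L (- int m) w = 0 \<cdot> L (-2) \<omega> + 1 \<cdot> L (-4) \<one>" using step by simp
    then have "\<exists>x y. L (- int m) w = x \<cdot> L (-2) \<omega> + y \<cdot> L (-4) \<one>" by blast
    then show ?thesis using 8 by simp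
  next
    case 9
    then have "L (- int m) w = 0 \<cdot> L (-2) \<omega> + 0 \<cdot> L (-4) \<one>" using step by simp
    then have "\<exists>x y. L (- int m) w = x \<cdot> L (-2) \<omega> + y \<cdot> L (-4) \<one>" by blast
    then show ?thesis using 9 by simp
  next
    case 10
    then obtain x where "w = x \<cdot> \<omega>" using step by auto
    then have "L (- int m) w = x \<cdot> L (-2) \<omega> + 0 \<cdot> L (-4) \<one>" using 10 by (simp add: virasoro_scale)
    then have "\<exists>x y. L (- int m) w = x \<cdot> L (-2) \<omega> + y \<cdot> L (-4) \<one>" by blast
    then show ?thesis using 10 by simp
  next
    case 11
    then obtain x where "w = x \<cdot> L (-3) \<one>" using step by auto
    then have "L (- int m) w = 0 \<cdot> L (-2) \<omega> + (x * 2) \<cdot> L (-4) \<one>"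
      using 11 by (simp add: virasoro_scale translation_virasoro_3)
    then have "\<exists>x y. L (- int m) w = x \<cdot> L (-2) \<omega> + y \<cdot> L (-4) \<one>" by blast
    then show ?thesis using 11 by simp
  qed
qed simp

lemma virasoro_submodule_weight_2:
  assumes "v \<in> virasoro_submodule V" "v \<in> weight 2"
  obtains x where "v = x \<cdot> \<omega>"
proof -
  have "v \<in> span {w. descendant 2 w}"
    using virasoro_submodule_homogeneous[of v 2] assms by simp
  also have "\<dots> \<subseteq> span {\<omega>}"
  proof (rule span_minimal)
    show "{w. descendant 2 w} \<subseteq> span {\<omega>}"
    proof
      fix w assume "w \<in> {w. descendant 2 w}"
      then obtain x where "w = x \<cdot> \<omega>" using descendant_low[of 2 w] by auto
      then show "w \<in> span {\<omega>}" by (auto simp: span_singleton)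
    qed
  qed simp
  finally show ?thesis using that by (auto simp: span_singleton)
qed

lemma virasoro_submodule_weight_4:
  assumes "v \<in> virasoro_submodule V" "v \<in> weight 4"
  obtains x y where "v = x \<cdot> L (-2) \<omega> + y \<cdot> L (-4) \<one>"
proof -
  let ?S = "{L (-2) \<omega>, L (-4) \<one>}"
  have "v \<in> span {w. descendant 4 w}"
    using virasoro_submodule_homogeneous[of v 4] assms by simp
  also have "\<dots> \<subseteq> span ?S"
  proof (rule span_minimal)
    show "{w. descendant 4 w} \<subseteq> span ?S"
    proof
      fix w assume "w \<in> {w. descendant 4 w}"
      then obtain x y where "w = x \<cdot> L (-2) \<omega> + y \<cdot> L (-4) \<one>" using descendant_low[of 4 w] by auto
      moreover have "L (-2) \<omega> \<in> span ?S" "L (-4) \<one> \<in> span ?S" by (rule span_base; simp)+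
      ultimately show "w \<in> span ?S" using span_add span_scale by blast
    qed
  qed simp
  finally obtain x where "v - x \<cdot> L (-2) \<omega> \<in> span {L (-4) \<one>}"
    using span_breakdown_eq[of v "L (-2) \<omega>" "{L (-4) \<one>}"] by auto
  then obtain y where "v - x \<cdot> L (-2) \<omega> = y \<cdot> L (-4) \<one>" by (auto simp: span_singleton)
  then have "v = x \<cdot> L (-2) \<omega> + y \<cdot> L (-4) \<one>" by (metis add.commute diff_add_cancel)
  then show ?thesis by (rule that)
qed

section \<open>The form on the Griess algebra\<close>

lemma griess_weight: "griess V = weight 2"
  by (simp add: griess_def weight_space_weight)

lemma mode_high:
  assumes "a \<in> weight 2" "b \<in> weight 2"
  shows "n > 3 \<Longrightarrow> a\<^bsub>(n)\<^esub> b = 0" "a\<^bsub>(2)\<^esub> b = 0"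
  using weight_mode[OF _ assms, of n] weight_mode[OF _ assms, of 2] weight_negative[of "3 - n"] weight_1
  by auto

lemma griess_form:
  assumes "a \<in> weight 2" "b \<in> weight 2"
  shows "a\<^bsub>(3)\<^esub> b = griess_form V a b \<cdot> \<one>"
proof -
  have "a\<^bsub>(3)\<^esub> b \<in> weight 0" using weight_mode[OF _ assms, of 3] by simp
  then obtain z where z: "a\<^bsub>(3)\<^esub> b = z \<cdot> \<one>" by (auto simp: weight_0)
  then have "griess_form V a b = z"
    unfolding griess_form_def using vac_nonzero by (intro the_equality) auto
  then show ?thesis using z by simp
qed

text \<open>Skew symmetry: the Borcherds identity with \<open>p = -1\<close>, \<open>r = 3\<close>, \<open>q = 0\<close>, applied to \<open>\<one>\<close>.\<close>

lemma griess_form_commute: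
  assumes "a \<in> weight 2" "b \<in> weight 2"
  shows "griess_form V a b = griess_form V b a"
proof -
  let ?f = "\<lambda>i::nat. smul V ((of_int (-1) :: complex) gchoose i)
          (mode V (mode V a (3 + int i) b) (-1 + 0 - int i) \<one>)"
  let ?g = "\<lambda>i::nat. smul V ((-1) ^ i * ((of_int 3 :: complex) gchoose i))
          (mode V a (-1 + 3 - int i) (mode V b (0 + int i) \<one>)
           - smul V ((-1) powi 3)
               (mode V b (0 + 3 - int i) (mode V a (-1 + int i) \<one>)))"
  have f: "Sum_any ?f = sum ?f {0}"
    by (rule Sum_any_eq_sum) (simp_all add: mode_high[OF assms])
  have g: "Sum_any ?g = sum ?g {0}"
    by (rule Sum_any_eq_sum) (simp_all add: mode_vac_nonneg)
  have "a\<^bsub>(3)\<^esub> b = b\<^bsub>(3)\<^esub> a"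
    using borcherds[of "-1" a 3 b 0 \<one>] unfolding f g by (simp add: creation mode_vac_nonneg)
  then show ?thesis using vac_nonzero by (simp add: griess_form assms)
qed

lemma virasoro_griess:
  assumes "a \<in> weight 2"
  shows "L 0 a = 2 \<cdot> a" "L 1 a = 0" "L 2 a = griess_form V a \<omega> \<cdot> \<one>" "m \<ge> 3 \<Longrightarrow> L m a = 0"
  using assms mode_high(1)[OF conf_weight assms, of "m + 1"] mode_high(2)[OF conf_weight assms] griess_form[OF conf_weight assms]
    griess_form_commute[OF conf_weight assms]
  by (simp_all add: weight_def virasoro_def)

lemma conf_mode_griess:
  assumes "a \<in> weight 2"
  shows "\<omega>\<^bsub>(0)\<^esub> a = L (-1) a" "\<omega>\<^bsub>(1)\<^esub> a = 2 \<cdot> a" "\<omega>\<^bsub>(2)\<^esub> a = 0" "\<omega>\<^bsub>(3)\<^esub> a = griess_form V a \<omega> \<cdot> \<one>"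
    "\<omega>\<^bsub>(4)\<^esub> a = 0" "\<omega>\<^bsub>(5)\<^esub> a = 0"
  using virasoro_griess[OF assms] virasoro_griess(4)[OF assms, of 3]  virasoro_griess(4)[OF assms, of 4]
  by (simp_all add: virasoro_def)

lemma translation_griess: "a \<in> weight 2 \<Longrightarrow> (L (-1) a)\<^bsub>(q)\<^esub> u = (- of_int q) \<cdot> a\<^bsub>(q - 1)\<^esub> u"
  by (rule translation_range_L0[OF weight_range_L0]) auto

lemma griess_form_conf: "griess_form V \<omega> \<omega> = c / 2"
  using virasoro_griess(3)[OF conf_weight] virasoro_conf[of 2] vac_nonzero by simp

lemma conf_commutator_griess:
  assumes a: "a \<in> weight 2"
  shows "\<omega>\<^bsub>(3)\<^esub> (a\<^bsub>(q)\<^esub> u) = a\<^bsub>(q)\<^esub> (\<omega>\<^bsub>(3)\<^esub> u) + (3 - of_int q) \<cdot> a\<^bsub>(q + 2)\<^esub> u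
      + griess_form V a \<omega> \<cdot> \<one>\<^bsub>(q)\<^esub> u" (is ?A)
    and "\<omega>\<^bsub>(5)\<^esub> (a\<^bsub>(q)\<^esub> u) = a\<^bsub>(q)\<^esub> (\<omega>\<^bsub>(5)\<^esub> u) + (5 - of_int q) \<cdot> a\<^bsub>(q + 4)\<^esub> u
      + (10 * griess_form V a \<omega>) \<cdot> \<one>\<^bsub>(q + 2)\<^esub> u" (is ?B)
proof -
  note w = conf_mode_griess[OF a] translation_griess[OF a] mode_scale_left
  have bin: "3 choose 1 = (3::nat)" "3 choose 2 = (3::nat)" "5 choose 1 = (5::nat)"
    "5 choose 2 = (10::nat)" "5 choose 3 = (10::nat)"
    by (simp_all add: eval_nat_numeral)
  have sum3: "(\<Sum>i\<le>3. f i) = f 0 + f 1 + f 2 + f 3" for f :: "nat \<Rightarrow> 'v"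
    by (simp add: eval_nat_numeral)
  have sum5: "(\<Sum>i\<le>5. f i) = f 0 + f 1 + f 2 + f 3 + f 4 + f 5" for f :: "nat \<Rightarrow> 'v"
    by (simp add: eval_nat_numeral)
  have "\<omega>\<^bsub>(3)\<^esub> (a\<^bsub>(q)\<^esub> u) - a\<^bsub>(q)\<^esub> (\<omega>\<^bsub>(3)\<^esub> u) =
      (- (3 + of_int q)) \<cdot> a\<^bsub>(2 + q)\<^esub> u + 6 \<cdot> a\<^bsub>(2 + q)\<^esub> u + griess_form V a \<omega> \<cdot> \<one>\<^bsub>(q)\<^esub> u"
    using commutator_nonneg[of 3 \<omega> a q u] by (simp add: sum3 bin w)
  also have "(- (3 + of_int q)) \<cdot> a\<^bsub>(2 + q)\<^esub> u + 6 \<cdot> a\<^bsub>(2 + q)\<^esub> u = (3 - of_int q) \<cdot> a\<^bsub>(q + 2)\<^esub> u"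
    unfolding scale_left_distrib[symmetric] by (simp add: add.commute)
  finally show ?A by (simp add: algebra_simps)
  have "\<omega>\<^bsub>(5)\<^esub> (a\<^bsub>(q)\<^esub> u) - a\<^bsub>(q)\<^esub> (\<omega>\<^bsub>(5)\<^esub> u) =
      (- (5 + of_int q)) \<cdot> a\<^bsub>(4 + q)\<^esub> u + 10 \<cdot> a\<^bsub>(4 + q)\<^esub> u + (10 * griess_form V a \<omega>) \<cdot> \<one>\<^bsub>(2 + q)\<^esub> u"
    using commutator_nonneg[of 5 \<omega> a q u] by (simp add: sum5 bin w)
  also have "(- (5 + of_int q)) \<cdot> a\<^bsub>(4 + q)\<^esub> u + 10 \<cdot> a\<^bsub>(4 + q)\<^esub> u = (5 - of_int q) \<cdot> a\<^bsub>(q + 4)\<^esub> u"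
    unfolding scale_left_distrib[symmetric] by (simp add: add.commute)
  finally show ?B by (simp add: algebra_simps)
qed

lemma virasoro_2_griess_product:
  assumes "a \<in> weight 2" "b \<in> weight 2"
  shows "L 2 (a\<^bsub>(1)\<^esub> b) = (2 * griess_form V a b) \<cdot> \<one>"
  using conf_commutator_griess(1)[OF assms(1), of 1 b]
  by (simp add: virasoro_def conf_mode_griess[OF assms(2)] griess_form[OF assms] vac_mode_int
      mode_nonneg_right mode_vac_nonneg)

lemma virasoro_4_normal_product:
  assumes "a \<in> weight 2" "b \<in> weight 2"
  shows "L 4 (a\<^bsub>(-1)\<^esub> b) = (6 * griess_form V a b) \<cdot> \<one>"
  using conf_commutator_griess(2)[OF assms(1), of "-1" b]
  by (simp add: virasoro_def conf_mode_griess[OF assms(2)] griess_form[OF assms] vac_mode_int)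

lemma virasoro_2_normal_product:
  assumes "a \<in> weight 2" "b \<in> weight 2"
  shows "L 2 (a\<^bsub>(-1)\<^esub> b) = 4 \<cdot> a\<^bsub>(1)\<^esub> b + griess_form V a \<omega> \<cdot> b + griess_form V b \<omega> \<cdot> a"
  using conf_commutator_griess(1)[OF assms(1), of "-1" b]
  by (simp add: virasoro_def conf_mode_griess[OF assms(2)] vac_mode_int mode_scaled_vac creation)

lemma virasoro_2_2_normal_product:
  assumes "a \<in> weight 2" "b \<in> weight 2"
  shows "L 2 (L 2 (a\<^bsub>(-1)\<^esub> b)) =
    (8 * griess_form V a b + 2 * griess_form V a \<omega> * griess_form V b \<omega>) \<cdot> \<one>"
  unfolding virasoro_2_normal_product[OF assms] virasoro_add virasoro_scale
    virasoro_2_griess_product[OF assms] virasoro_griess(3)[OF assms(1)] virasoro_griess(3)[OF assms(2)]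
    scale_scale scale_left_distrib[symmetric]
  by (simp add: algebra_simps)

lemma virasoro_weight_4_basis:
  "L 4 (L (-2) \<omega>) = (3 * c) \<cdot> \<one>" "L 4 (L (-4) \<one>) = (5 * c) \<cdot> \<one>"
  "L 2 (L 2 (L (-2) \<omega>)) = (c * (c + 8) / 2) \<cdot> \<one>" "L 2 (L 2 (L (-4) \<one>)) = (3 * c) \<cdot> \<one>"
proof -
  have sw: "L (int n) (L m u) = L m (L (int n) u) + of_int (int n - m) \<cdot> L (m + int n) u
      - (if m + int n = 0 then of_int (m ^ 3 - m) / 12 * c else 0) \<cdot> u" for m n u
    using virasoro_bracket[of m n u] by (simp add: algebra_simps)
  show "L 4 (L (-2) \<omega>) = (3 * c) \<cdot> \<one>"
    using sw[of 4 "-2" \<omega>] by (simp add: virasoro_conf)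
  show "L 4 (L (-4) \<one>) = (5 * c) \<cdot> \<one>"
    using sw[of 4 "-4" \<one>] by (simp add: virasoro_vac)
  have "L 2 (L (-2) \<omega>) = (c / 2) \<cdot> \<omega> + 8 \<cdot> \<omega> - (- c / 2) \<cdot> \<omega>"
    using sw[of 2 "-2" \<omega>] by (simp add: virasoro_conf virasoro_scale conf_eq)
  also have "\<dots> = (c + 8) \<cdot> \<omega>"
    unfolding scale_left_distrib[symmetric] scale_left_diff_distrib[symmetric] by simp
  finally have "L 2 (L (-2) \<omega>) = (c + 8) \<cdot> \<omega>" .
  then show "L 2 (L 2 (L (-2) \<omega>)) = (c * (c + 8) / 2) \<cdot> \<one>"
    by (simp add: virasoro_scale virasoro_conf mult.commute)
  have "L 2 (L (-4) \<one>) = 6 \<cdot> \<omega>"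
    using sw[of 2 "-4" \<one>] by (simp add: virasoro_vac conf_eq)
  then show "L 2 (L 2 (L (-4) \<one>)) = (3 * c) \<cdot> \<one>"
    by (simp add: virasoro_scale virasoro_conf)
qed

section \<open>Automorphisms and averages\<close>

lemma Aut_mode: "g \<in> Aut V \<Longrightarrow> g (a\<^bsub>(n)\<^esub> b) = (g a)\<^bsub>(n)\<^esub> (g b)"
  and Aut_conf: "g \<in> Aut V \<Longrightarrow> g \<omega> = \<omega>"
  and Aut_bij: "g \<in> Aut V \<Longrightarrow> bij g"
  and Aut_add: "g \<in> Aut V \<Longrightarrow> g (u + v) = g u + g v"
  and Aut_scale: "g \<in> Aut V \<Longrightarrow> g (x \<cdot> u) = x \<cdot> g u"
  by (auto simp: Aut_def Vector_Spaces.linear_iff)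

lemma Aut_zero: "g \<in> Aut V \<Longrightarrow> g 0 = 0"
  using Aut_scale[of g 0 0] by simp

lemma Aut_diff: "g \<in> Aut V \<Longrightarrow> g (u - v) = g u - g v"
  by (metis Aut_add add_diff_cancel_right' diff_add_cancel)

lemma Aut_sum: "g \<in> Aut V \<Longrightarrow> g (sum f A) = (\<Sum>i\<in>A. g (f i))"
  by (induction A rule: infinite_finite_induct) (auto simp: Aut_zero Aut_add)

lemma Aut_virasoro: "g \<in> Aut V \<Longrightarrow> g (L m u) = L m (g u)"
  by (simp add: virasoro_def Aut_mode Aut_conf)

lemma Aut_weight: "g \<in> Aut V \<Longrightarrow> u \<in> weight k \<Longrightarrow> g u \<in> weight k"
  by (simp add: weight_def flip: Aut_virasoro Aut_scale)

lemma Aut_vac: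
  assumes g: "g \<in> Aut V"
  shows "g \<one> = \<one>"
proof -
  obtain a where a: "g a = \<one>" using Aut_bij[OF g] by (metis bij_pointE)
  have "g \<one> = (g \<one>)\<^bsub>(-1)\<^esub> (g a)" by (simp add: a creation)
  also have "\<dots> = \<one>" using Aut_mode[OF g, of \<one> "-1" a] by (simp add: vac_mode_minus_one a)
  finally show ?thesis .
qed

lemma Aut_comp: "g \<in> Aut V \<Longrightarrow> h \<in> Aut V \<Longrightarrow> g \<circ> h \<in> Aut V"
  unfolding Aut_def by (auto simp: Vector_Spaces.linear_iff bij_comp)

lemma Aut_id: "id \<in> Aut V"
  unfolding Aut_def by (auto simp: Vector_Spaces.linear_iff vector_space)

lemma Aut_inv:
  assumes g: "g \<in> Aut V"
  shows "inv g \<in> Aut V"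
proof -
  have b: "bij g" by (rule Aut_bij[OF g])
  have gi: "g (inv g u) = u" for u using b by (simp add: bij_is_surj surj_f_inv_f)
  have eqI: "inv g u = v" if "u = g v" for u v using b that by (simp add: bij_is_inj)
  show ?thesis
    unfolding Aut_def mem_Collect_eq
  proof (intro conjI allI)
    show "Vector_Spaces.linear (smul V) (smul V) (inv g)"
      unfolding Vector_Spaces.linear_iff
      by (intro conjI allI vector_space eqI) (simp_all add: Aut_add[OF g] Aut_scale[OF g] gi)
    show "bij (inv g)" using b by (rule bij_imp_bij_inv)
    show "inv g (a\<^bsub>(n)\<^esub> b) = (inv g a)\<^bsub>(n)\<^esub> (inv g b)" for a n b
      by (rule eqI) (simp add: Aut_mode[OF g] gi)
    show "inv g \<omega> = \<omega>" by (rule eqI) (simp add: Aut_conf[OF g])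
  qed
qed

lemma Aut_weight_space_upto:
  assumes g: "g \<in> Aut V" and "u \<in> weight_space_upto V n"
  shows "g u \<in> weight_space_upto V n"
  using assms(2) unfolding weight_space_upto_def
proof (induction rule: span_induct_alt)
  case base
  then show ?case by (simp add: Aut_zero[OF g] span_zero)
next
  case (step z x y)
  then have "g x \<in> span (\<Union>m\<le>n. weight_space V m)"
    using Aut_weight[OF g] by (auto simp: weight_space_weight intro!: span_base)
  then show ?case using step by (simp add: Aut_add[OF g] Aut_scale[OF g] span_add span_scale)
qed

lemma virasoro_submodule_closed:
  "subspace (virasoro_submodule V)" "w \<in> virasoro_submodule V \<Longrightarrow> L m w \<in> virasoro_submodule V"
  "\<one> \<in> virasoro_submodule V"
  unfolding virasoro_submodule_def hull_def subspace_def by blast+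

lemma Aut_virasoro_submodule:
  assumes g: "g \<in> Aut V" and "u \<in> virasoro_submodule V"
  shows "g u \<in> virasoro_submodule V"
proof -
  have "virasoro_submodule V \<subseteq> {u. g u \<in> virasoro_submodule V}"
    unfolding virasoro_submodule_def[of V, THEN arg_cong[where f = "\<lambda>S. S \<subseteq> _"]]
  proof (rule hull_minimal)
    show "{\<one>} \<subseteq> {u. g u \<in> virasoro_submodule V}"
      using virasoro_submodule_closed(3) by (simp add: Aut_vac[OF g])
    show "subspace {u. g u \<in> virasoro_submodule V} \<and>
        (\<forall>m. \<forall>w\<in>{u. g u \<in> virasoro_submodule V}. L m w \<in> {u. g u \<in> virasoro_submodule V})"
      using virasoro_submodule_closed(1,2)
      by (auto simp: subspace_def Aut_zero[OF g] Aut_add[OF g] Aut_scale[OF g] Aut_virasoro[OF g])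
  qed
  then show ?thesis using assms(2) by blast
qed

text \<open>The class of an invariant vector is a fixed vector of the quotient.\<close>

lemma class_S_invariant:
  assumes S: "class_S V n" and u: "u \<in> weight (int k)" "k \<le> n" and inv: "\<And>g. g \<in> Aut V \<Longrightarrow> g u = u"
  shows "u \<in> virasoro_submodule V"
proof -
  let ?U = "weight_space_upto V n" and ?K = "virasoro_submodule V \<inter> weight_space_upto V n"
  define R where "R = {(u, v). u \<in> ?U \<and> v \<in> ?U \<and> u - v \<in> ?K}"
  have uU: "u \<in> ?U"
    unfolding weight_space_upto_def weight_space_weight using u by (intro span_base UN_I) auto
  have "0 \<in> ?K"
    unfolding weight_space_upto_def using subspace_0[OF virasoro_submodule_closed(1)] span_zero by blast
  have closed: "g v \<in> R `` {u}" if "g \<in> Aut V" "v \<in> R `` {u}" for g v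
  proof -
    have "g (u - v) \<in> ?K"
      using that(2) Aut_weight_space_upto[OF that(1)] Aut_virasoro_submodule[OF that(1)] by (simp add: R_def)
    then have "u - g v \<in> ?K" by (simp add: Aut_diff[OF that(1)] inv[OF that(1)])
    then show ?thesis using that(2) uU Aut_weight_space_upto[OF that(1)] by (simp add: R_def)
  qed
  have "g ` (R `` {u}) = R `` {u}" if g: "g \<in> Aut V" for g
  proof
    show "g ` (R `` {u}) \<subseteq> R `` {u}" using closed[OF g] by blast
    show "R `` {u} \<subseteq> g ` (R `` {u})"
    proof
      fix v assume "v \<in> R `` {u}"
      then have "inv g v \<in> R `` {u}" by (rule closed[OF Aut_inv[OF g]])
      moreover have "g (inv g v) = v" using Aut_bij[OF g] by (simp add: bij_is_surj surj_f_inv_f)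
      ultimately show "v \<in> g ` (R `` {u})" by (metis imageI)
    qed
  qed
  then have fixed: "\<forall>g\<in>Aut V. g ` (R `` {u}) = R `` {u}" by (rule ballI)
  have "R `` {u} \<in> class_S_quotient V n"
    unfolding class_S_quotient_def R_def by (rule quotientI[OF uU])
  with S have "(\<forall>g\<in>Aut V. g ` (R `` {u}) = R `` {u}) \<longrightarrow> R `` {u} = ?K"
    unfolding class_S_def by (rule bspec)
  then have "R `` {u} = ?K" using fixed by (rule mp)
  moreover have "u \<in> R `` {u}" using uU \<open>0 \<in> ?K\<close> by (simp add: R_def)
  ultimately have "u \<in> ?K" by (simp only:)
  then show ?thesis by (rule IntD1)
qed

definition avg :: "'v \<Rightarrow> 'v" where
  "avg u = (1 / of_nat (card (Aut V))) \<cdot> (\<Sum>g\<in>Aut V. g u)"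

context
  assumes finite_Aut: "finite (Aut V)"
begin

lemma card_Aut: "of_nat (card (Aut V)) \<noteq> (0 :: complex)"
  using finite_Aut Aut_id by auto

lemma avg_scale: "avg (x \<cdot> u) = x \<cdot> avg u"
  by (simp add: avg_def Aut_scale mult.commute flip: scale_sum_right)

lemma avg_vac: "avg \<one> = \<one>"
  using card_Aut by (simp add: avg_def Aut_vac sum_constant_scale)

lemma avg_weight: "u \<in> weight k \<Longrightarrow> avg u \<in> weight k"
  unfolding avg_def using subspace_weight Aut_weight by (auto intro!: subspace_scale subspace_sum)

lemma virasoro_sum: "L m (sum f A) = (\<Sum>i\<in>A. L m (f i))"
  by (induction A rule: infinite_finite_induct) (auto simp: virasoro_add)

lemma virasoro_avg: "L m (avg u) = avg (L m u)"
  by (simp add: avg_def virasoro_scale virasoro_sum Aut_virasoro)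

lemma avg_invariant:
  assumes h: "h \<in> Aut V"
  shows "h (avg u) = avg u"
proof -
  have inj: "inj_on ((\<circ>) h) (Aut V)"
  proof (rule inj_onI)
    fix f g assume "h \<circ> f = h \<circ> g"
    then have "h (f u) = h (g u)" for u by (metis comp_apply)
    then show "f = g" using Aut_bij[OF h] by (auto simp: bij_def inj_def)
  qed
  have img: "(\<circ>) h ` Aut V = Aut V"
    using Aut_comp[OF h] inj finite_Aut by (intro endo_inj_surj) auto
  have "(\<Sum>g\<in>Aut V. h (g u)) = (\<Sum>g\<in>(\<circ>) h ` Aut V. g u)"
    using inj by (simp add: sum.reindex)
  then show ?thesis by (simp add: avg_def Aut_scale[OF h] Aut_sum[OF h] img)
qed

lemma avg_griess:
  assumes S: "class_S V n" "n \<ge> 2" and a: "a \<in> weight 2"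
  shows "avg a = (2 * griess_form V a \<omega> / c) \<cdot> \<omega>"
proof -
  have "avg a \<in> virasoro_submodule V"
    using class_S_invariant[OF S(1), of "avg a" 2] S(2) avg_weight[OF a] avg_invariant by simp
  then obtain x where x: "avg a = x \<cdot> \<omega>"
    using virasoro_submodule_weight_2 avg_weight[OF a] by blast
  have "(x * (c / 2)) \<cdot> \<one> = L 2 (avg a)" by (simp add: x virasoro_scale virasoro_conf)
  also have "\<dots> = griess_form V a \<omega> \<cdot> \<one>"
    by (simp add: virasoro_avg virasoro_griess(3)[OF a] avg_scale avg_vac)
  finally have "x * (c / 2) = griess_form V a \<omega>" using vac_nonzero by simp
  then have "x = 2 * griess_form V a \<omega> / c" using rank_nonzero by (simp add: field_simps)
  then show ?thesis using x by simp
qed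

lemma avg_griess_product:
  assumes S: "class_S V n" "n \<ge> 2" and a: "a \<in> weight 2" and b: "b \<in> weight 2"
  shows "avg (a\<^bsub>(1)\<^esub> b) = (4 * griess_form V a b / c) \<cdot> \<omega>"
proof -
  have ab: "a\<^bsub>(1)\<^esub> b \<in> weight 2" using weight_mode[OF _ a b, of 1] by simp
  have "griess_form V (a\<^bsub>(1)\<^esub> b) \<omega> = 2 * griess_form V a b"
    using virasoro_griess(3)[OF ab] virasoro_2_griess_product[OF a b] vac_nonzero by simp
  then show ?thesis using avg_griess[OF S ab] by simp
qed

text \<open>The two coefficients are determined by \<open>L\<^sub>2\<^sup>2\<close> and \<open>L\<^sub>4\<close>; up to sign the determinant is \<open>c\<^sup>2 (5c + 22) / 2\<close>.\<close>

lemma avg_normal_product: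
  assumes S: "class_S V 4" and c: "5 * c + 22 \<noteq> 0" and a: "a \<in> weight 2" and b: "b \<in> weight 2"
  defines "\<alpha> \<equiv> (44 * griess_form V a b + 20 * griess_form V a \<omega> * griess_form V b \<omega>) / (c * (5 * c + 22))"
  shows "avg (a\<^bsub>(-1)\<^esub> b) = \<alpha> \<cdot> L (-2) \<omega> + ((6 * griess_form V a b - 3 * c * \<alpha>) / (5 * c)) \<cdot> L (-4) \<one>"
proof -
  let ?ab = "griess_form V a b" and ?p = "griess_form V a \<omega> * griess_form V b \<omega>"
  have ab: "a\<^bsub>(-1)\<^esub> b \<in> weight 4" using weight_mode[OF _ a b, of "-1"] by simp
  have "avg (a\<^bsub>(-1)\<^esub> b) \<in> virasoro_submodule V"
    using class_S_invariant[OF S, of "avg (a\<^bsub>(-1)\<^esub> b)" 4] avg_weight[OF ab] avg_invariant by simp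
  then obtain x y where xy: "avg (a\<^bsub>(-1)\<^esub> b) = x \<cdot> L (-2) \<omega> + y \<cdot> L (-4) \<one>"
    using virasoro_submodule_weight_4 avg_weight[OF ab] by blast
  have "(x * (3 * c) + y * (5 * c)) \<cdot> \<one> = L 4 (avg (a\<^bsub>(-1)\<^esub> b))"
    by (simp add: xy virasoro_linear virasoro_weight_4_basis scale_left_distrib)
  also have "\<dots> = (6 * ?ab) \<cdot> \<one>"
    by (simp add: virasoro_avg virasoro_4_normal_product[OF a b] avg_scale avg_vac)
  finally have 1: "x * (3 * c) + y * (5 * c) = 6 * ?ab" using vac_nonzero by simp
  have "(x * (c * (c + 8) / 2) + y * (3 * c)) \<cdot> \<one> = L 2 (L 2 (avg (a\<^bsub>(-1)\<^esub> b)))"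
    by (simp add: xy virasoro_linear virasoro_weight_4_basis scale_left_distrib)
  also have "\<dots> = (8 * ?ab + 2 * ?p) \<cdot> \<one>"
    by (simp add: virasoro_avg virasoro_2_2_normal_product[OF a b] avg_scale avg_vac mult.assoc)
  finally have 2: "x * (c * (c + 8) / 2) + y * (3 * c) = 8 * ?ab + 2 * ?p" using vac_nonzero by simp
  \<comment> \<open>eliminate \<open>y\<close>\<close>
  have "x * (c * (5 * c + 22)) = 10 * (x * (c * (c + 8) / 2) + y * (3 * c)) - 6 * (x * (3 * c) + y * (5 * c))"
    by (simp add: algebra_simps)
  also have "\<dots> = 44 * ?ab + 20 * ?p" unfolding 1 2 by simp
  finally have eq: "x * (c * (5 * c + 22)) = 44 * ?ab + 20 * ?p" .
  have "c * (5 * c + 22) \<noteq> 0" using c rank_nonzero by simp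
  then have "x = \<alpha>" using eq unfolding \<alpha>_def mult.assoc by (rule nonzero_eq_divide_eq[THEN iffD2])
  moreover have "y = (6 * ?ab - 3 * c * x) / (5 * c)" using 1 rank_nonzero by (simp add: field_simps)
  ultimately show ?thesis using xy by simp
qed

end

section \<open>Graded traces\<close>

text \<open>
  The operators whose graded traces are taken. Linearity is asked for on each weight space only,
  which is what is known for the modes and what the trace sees.
\<close>

definition lowers :: "int \<Rightarrow> ('v \<Rightarrow> 'v) \<Rightarrow> bool" where
  "lowers k f \<longleftrightarrow> (\<forall>n. linear_on (weight n) f \<and> (\<forall>v\<in>weight n. f v \<in> weight (n - k)))"

abbreviation "gtr \<equiv> graded_trace V"

lemma gtr_nth: "fps_nth (gtr f) n = trace_on (smul V) (weight (int n)) f"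
  by (simp add: graded_trace_def weight_space_weight)

lemma gtr_cong: "(\<And>n v. v \<in> weight (int n) \<Longrightarrow> f v = g v) \<Longrightarrow> gtr f = gtr g"
  by (rule fps_ext) (auto simp: gtr_nth intro: trace_on_cong[OF fin_dim_weight])

lemma lowers_weight: "lowers k f \<Longrightarrow> v \<in> weight n \<Longrightarrow> f v \<in> weight (n - k)"
  by (simp add: lowers_def)

lemma lowers_0: "lowers 0 f \<Longrightarrow> v \<in> weight n \<Longrightarrow> f v \<in> weight n"
  using lowers_weight[of 0 f v n] by simp

lemma lowers_linear: "lowers k f \<Longrightarrow> linear_on (weight n) f"
  by (simp add: lowers_def)

lemma lowers_at_zero: "lowers k f \<Longrightarrow> f 0 = 0"
  using linear_onD(3)[OF lowers_linear, of k f 0 0 0 0] subspace_0[OF subspace_weight] by simp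

lemma lowers_comp:
  assumes f: "lowers j f" and g: "lowers k g"
  shows "lowers (j + k) (\<lambda>v. f (g v))"
  unfolding lowers_def
proof (intro allI conjI ballI)
  fix n
  show "linear_on (weight n) (\<lambda>v. f (g v))"
    using linear_onD(1)[OF lowers_linear[OF f, of "n - k"]] linear_onD(1)[OF lowers_linear[OF g]]
      lowers_weight[OF g]
    by (simp add: linear_on_def)
  show "f (g v) \<in> weight (n - (j + k))" if "v \<in> weight n" for v
    using lowers_weight[OF f lowers_weight[OF g that]] by (simp add: algebra_simps)
qed

lemma lowers_mode:
  assumes "j \<noteq> 0" "a \<in> weight j"
  shows "lowers k (mode V a (k + j - 1))"
  using linear_on_weight weight_mode[OF assms, of _ _ "k + j - 1"] by (auto simp: lowers_def)

lemma lowers_griess: "a \<in> weight 2 \<Longrightarrow> lowers k (mode V a (k + 1))"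
  using lowers_mode[of 2 a k] by (simp add: add.commute)

lemma gtr_add: "lowers 0 f \<Longrightarrow> lowers 0 g \<Longrightarrow> gtr (\<lambda>v. f v + g v) = gtr f + gtr g"
  by (rule fps_ext) (simp add: gtr_nth trace_on_add[OF fin_dim_weight] lowers_0)

lemma gtr_scale: "lowers 0 f \<Longrightarrow> gtr (\<lambda>v. z \<cdot> f v) = fps_const z * gtr f"
  by (rule fps_ext) (simp add: gtr_nth trace_on_scale[OF fin_dim_weight] lowers_0)

lemma gtr_sum: "finite A \<Longrightarrow> (\<And>i. i \<in> A \<Longrightarrow> lowers 0 (f i)) \<Longrightarrow> gtr (\<lambda>v. \<Sum>i\<in>A. f i v) = (\<Sum>i\<in>A. gtr (f i))"
  by (rule fps_ext) (simp add: gtr_nth trace_on_sum[OF fin_dim_weight] lowers_0 fps_sum_nth)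

lemma lowers_scale:
  assumes f: "lowers k f"
  shows "lowers k (\<lambda>v. z \<cdot> f v)"
  using f subspace_scale[OF subspace_weight] unfolding lowers_def linear_on_def
  by (simp add: scale_right_distrib mult.commute)

lemma lowers_add:
  assumes f: "lowers k f" and g: "lowers k g"
  shows "lowers k (\<lambda>v. f v + g v)"
  using f g subspace_add[OF subspace_weight] unfolding lowers_def linear_on_def
  by (simp add: scale_right_distrib algebra_simps)

lemma gtr_diff:
  assumes f: "lowers 0 f" and g: "lowers 0 g"
  shows "gtr (\<lambda>v. f v - g v) = gtr f - gtr g"
proof -
  have "gtr (\<lambda>v. f v - g v) = gtr (\<lambda>v. f v + (-1) \<cdot> g v)" by simp
  also have "\<dots> = gtr f + fps_const (-1) * gtr g"
    by (simp only: gtr_add[OF f lowers_scale[OF g]] gtr_scale[OF g])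
  also have "fps_const (-1) = (- 1 :: complex fps)" by (metis fps_const_neg fps_const_1_eq_1)
  finally show ?thesis by simp
qed

lemma gtr_scalar: "gtr (smul V z) = fps_const z * ch V"
  by (rule fps_ext) (simp add: gtr_nth trace_on_scalar[OF fin_dim_weight] ch_def weight_space_weight)

lemma gtr_virasoro_0:
  assumes "lowers 0 f"
  shows "gtr (\<lambda>v. L 0 (f v)) = q_deriv (gtr f)"
proof (rule fps_ext)
  fix n
  have "fps_nth (gtr (\<lambda>v. L 0 (f v))) n = fps_nth (gtr (\<lambda>v. of_nat n \<cdot> f v)) n"
    unfolding gtr_nth
  proof (rule trace_on_cong[OF fin_dim_weight])
    fix v assume "v \<in> weight (int n)"
    then have "f v \<in> weight (int n)" by (rule lowers_0[OF assms])
    then show "L 0 (f v) = of_nat n \<cdot> f v" by (simp add: weight_def)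
  qed
  then show "fps_nth (gtr (\<lambda>v. L 0 (f v))) n = fps_nth (q_deriv (gtr f)) n"
    by (simp add: gtr_scale[OF assms] q_deriv_nth)
qed

lemma lowers_ident: "lowers 0 (\<lambda>v. v)"
  by (simp add: lowers_def linear_on_def)

lemma gtr_ident: "gtr (\<lambda>v. v) = ch V"
  using gtr_scalar[of 1] by (simp add: scale_one[abs_def])

lemma gtr_L0: "gtr (mode V \<omega> 1) = q_deriv (ch V)"
  using gtr_virasoro_0[OF lowers_ident] gtr_ident by (simp add: virasoro_def)

lemma gtr_L0_L0: "gtr (\<lambda>v. \<omega>\<^bsub>(1)\<^esub> (\<omega>\<^bsub>(1)\<^esub> v)) = q_deriv (q_deriv (ch V))"
  using gtr_virasoro_0[of "mode V \<omega> 1"] lowers_griess[OF conf_weight, of 0] gtr_L0 by (simp add: virasoro_def)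

text \<open>Cyclicity of the trace, between the weight spaces of weights \<open>n\<close> and \<open>n - k\<close>.\<close>

lemma gtr_cyclic:
  assumes f: "lowers (int k) f" and g: "lowers (- int k) g"
  shows "gtr (\<lambda>v. g (f v)) = fps_X ^ k * gtr (\<lambda>v. f (g v))"
proof (rule fps_ext)
  fix n
  show "fps_nth (gtr (\<lambda>v. g (f v))) n = fps_nth (fps_X ^ k * gtr (\<lambda>v. f (g v))) n"
  proof (cases "n < k")
    case True
    have "trace_on (smul V) (weight (int n)) (\<lambda>v. g (f v)) = trace_on (smul V) (weight (int n)) (\<lambda>v. 0)"
    proof (rule trace_on_cong[OF fin_dim_weight])
      fix v assume "v \<in> weight (int n)"
      then have "f v \<in> weight (int n - int k)" by (rule lowers_weight[OF f])
      then have "f v = 0" using weight_negative[of "int n - int k"] True by simp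
      then show "g (f v) = 0" using lowers_at_zero[OF g] by simp
    qed
    then have "fps_nth (gtr (\<lambda>v. g (f v))) n = 0"
      unfolding gtr_nth using trace_on_zero[OF fin_dim_weight] by simp
    then show ?thesis using True by (simp add: fps_X_power_mult_nth)
  next
    case False
    then have k: "int n - int k = int (n - k)" and k': "int (n - k) - - int k = int n" by simp_all
    have "trace_on (smul V) (weight (int n)) (\<lambda>v. g (f v)) =
        trace_on (smul V) (weight (int (n - k))) (\<lambda>v. f (g v))"
    proof (rule trace_on_cyclic[OF fin_dim_weight fin_dim_weight lowers_linear[OF f] lowers_linear[OF g]])
      show "f v \<in> weight (int (n - k))" if "v \<in> weight (int n)" for v
        using lowers_weight[OF f that] unfolding k .
      show "g v \<in> weight (int n)" if "v \<in> weight (int (n - k))" for v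
        using lowers_weight[OF g that] unfolding k' .
    qed
    then show ?thesis using False by (simp add: gtr_nth fps_X_power_mult_nth)
  qed
qed

section \<open>The trace of a product of two zero modes\<close>

text \<open>Only \<open>a\<^sub>(\<^sub>0\<^sub>) b\<close>, \<open>a\<^sub>(\<^sub>1\<^sub>) b\<close> and \<open>a\<^sub>(\<^sub>3\<^sub>) b\<close> contribute, since \<open>a\<^sub>(\<^sub>2\<^sub>) b\<close> lies in \<open>V\<^sup>1 = 0\<close>.\<close>

lemma griess_commutator:
  assumes a: "a \<in> weight 2" and b: "b \<in> weight 2"
  shows "a\<^bsub>(k + 1)\<^esub> (b\<^bsub>(- k + 1)\<^esub> u) - b\<^bsub>(- k + 1)\<^esub> (a\<^bsub>(k + 1)\<^esub> u) =
    (a\<^bsub>(0)\<^esub> b)\<^bsub>(2)\<^esub> u + of_int (k + 1) \<cdot> (a\<^bsub>(1)\<^esub> b)\<^bsub>(1)\<^esub> u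
      + (of_int (k ^ 3 - k) / 6 * griess_form V a b) \<cdot> u"
proof -
  have bin: "(of_int (k + 1) :: complex) gchoose 3 = of_int (k ^ 3 - k) / 6"
    by (simp add: gbinomial_prod_rev eval_nat_numeral fact_numeral) (simp add: algebra_simps power3_eq_cube)
  have sum4: "(\<Sum>i<4. f i) = f 0 + f 1 + f 2 + f 3" for f :: "nat \<Rightarrow> 'v"
    by (simp add: eval_nat_numeral)
  have "a\<^bsub>(k + 1)\<^esub> (b\<^bsub>(- k + 1)\<^esub> u) - b\<^bsub>(- k + 1)\<^esub> (a\<^bsub>(k + 1)\<^esub> u) =
     (\<Sum>i<4. ((of_int (k + 1) :: complex) gchoose i) \<cdot> (a\<^bsub>(int i)\<^esub> b)\<^bsub>(k + 1 + (- k + 1) - int i)\<^esub> u)"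
    by (rule commutator) (simp add: mode_high[OF a b])
  also have "\<dots> = (a\<^bsub>(0)\<^esub> b)\<^bsub>(2)\<^esub> u + of_int (k + 1) \<cdot> (a\<^bsub>(1)\<^esub> b)\<^bsub>(1)\<^esub> u
      + (of_int (k ^ 3 - k) / 6 * griess_form V a b) \<cdot> u"
    unfolding sum4 by (simp add: bin mode_high[OF a b] griess_form[OF a b] scaled_vac_mode del: of_int_add)
  finally show ?thesis .
qed

text \<open>
  Put \<open>x\<^sub>k = a\<^sub>(\<^sub>k\<^sub>+\<^sub>1\<^sub>)\<close> and \<open>y\<^sub>k = b\<^sub>(\<^sub>k\<^sub>+\<^sub>1\<^sub>)\<close>, operators that lower the weight by \<open>k\<close>. Cyclicity turns
  the trace of the commutator of \<open>x\<^sub>k\<close> and \<open>y\<^sub>-\<^sub>k\<close> into \<open>1 - q\<^sup>k\<close> times the trace of \<open>x\<^sub>k y\<^sub>-\<^sub>k\<close>, and the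
  commutator itself is a combination of zero modes. Now \<open>(a\<^sub>(\<^sub>-\<^sub>1\<^sub>) b)\<^sub>(\<^sub>3\<^sub>)\<close> is the sum of the operators
  \<open>x\<^sub>-\<^sub>k y\<^sub>k\<close>, \<open>k \<ge> 2\<close>, and \<open>y\<^sub>-\<^sub>k x\<^sub>k\<close>, \<open>k \<ge> -1\<close>. Dividing by \<open>1 - q\<^sup>k\<close> and adding up the traces gives
  Lambert series, that is, divisor sums; the term \<open>k = 0\<close> is the trace in question.
\<close>

lemma trace_recursion:
  assumes a: "a \<in> weight 2" and b: "b \<in> weight 2"
  defines "S1 \<equiv> divisor_series of_nat" and "S3 \<equiv> divisor_series (\<lambda>k. of_nat k ^ 3)"
  shows "gtr (\<lambda>v. a\<^bsub>(1)\<^esub> (b\<^bsub>(1)\<^esub> v)) = gtr (mode V (a\<^bsub>(-1)\<^esub> b) 3)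
    - (1 + fps_const 2 * S1) * gtr (mode V (a\<^bsub>(1)\<^esub> b) 1)
    - fps_const (griess_form V a b / 3) * (S3 - S1) * ch V"
proof -
  let ?x = "\<lambda>k v. a\<^bsub>(k + 1)\<^esub> v" and ?y = "\<lambda>k v. b\<^bsub>(k + 1)\<^esub> v"
  define Z0 where "Z0 = gtr (mode V (a\<^bsub>(0)\<^esub> b) 2)"
  define Z1 where "Z1 = gtr (mode V (a\<^bsub>(1)\<^esub> b) 1)"
  define Z3 where "Z3 = fps_const (griess_form V a b) * ch V"
  define F where "F = gtr (\<lambda>v. ?x 0 (?y 0 v))"
  define T where "T k = gtr (\<lambda>v. ?x (int k) (?y (- int k) v))" for k
  define R where "R k = gtr (\<lambda>v. ?y (int k) (?x (- int k) v))" for k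
  have x: "lowers k (?x k)" and y: "lowers k (?y k)" for k
    using lowers_griess[OF a] lowers_griess[OF b] by auto
  have xy: "lowers 0 (\<lambda>v. ?x k (?y (- k) v))" "lowers 0 (\<lambda>v. ?y k (?x (- k) v))"
    "lowers 0 (\<lambda>v. ?x (- k) (?y k v))" "lowers 0 (\<lambda>v. ?y (- k) (?x k v))" for k
    using lowers_comp[OF x[of k] y[of "- k"]] lowers_comp[OF y[of k] x[of "- k"]]
      lowers_comp[OF x[of "- k"] y[of k]] lowers_comp[OF y[of "- k"] x[of k]] by simp_all
  have l0: "lowers 0 (mode V (a\<^bsub>(0)\<^esub> b) 2)"
    using lowers_mode[of 3 "a\<^bsub>(0)\<^esub> b" 0] weight_mode[OF _ a b, of 0] by simp
  have l1: "lowers 0 (mode V (a\<^bsub>(1)\<^esub> b) 1)"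
    using lowers_mode[of 2 "a\<^bsub>(1)\<^esub> b" 0] weight_mode[OF _ a b, of 1] by simp
  have comm: "gtr (\<lambda>v. ?x k (?y (- k) v)) - gtr (\<lambda>v. ?y (- k) (?x k v)) =
      Z0 + fps_const (of_int (k + 1)) * Z1 + fps_const (of_int (k ^ 3 - k) / 6) * Z3" for k
  proof -
    have "gtr (\<lambda>v. ?x k (?y (- k) v)) - gtr (\<lambda>v. ?y (- k) (?x k v)) =
        gtr (\<lambda>v. (a\<^bsub>(0)\<^esub> b)\<^bsub>(2)\<^esub> v + of_int (k + 1) \<cdot> (a\<^bsub>(1)\<^esub> b)\<^bsub>(1)\<^esub> v
          + (of_int (k ^ 3 - k) / 6 * griess_form V a b) \<cdot> v)"
      unfolding gtr_diff[OF xy(1) xy(4), symmetric] griess_commutator[OF a b] ..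
    also have "\<dots> = Z0 + fps_const (of_int (k + 1)) * Z1
        + fps_const (of_int (k ^ 3 - k) / 6 * griess_form V a b) * ch V"
      by (subst gtr_add gtr_scale, (intro lowers_add lowers_scale l0 l1 lowers_ident)+)+
        (simp only: Z0_def Z1_def gtr_ident)
    also have "fps_const (of_int (k ^ 3 - k) / 6 * griess_form V a b) * ch V = fps_const (of_int (k ^ 3 - k) / 6) * Z3"
      by (simp only: Z3_def fps_const_mult[symmetric] mult.assoc)
    finally show ?thesis .
  qed
  have yx: "gtr (\<lambda>v. ?y (- int k) (?x (int k) v)) = fps_X ^ k * T k" for k
    unfolding T_def by (rule gtr_cyclic[OF x y])
  have xy': "gtr (\<lambda>v. ?x (- int k) (?y (int k) v)) = fps_X ^ k * R k" for k
    unfolding R_def by (rule gtr_cyclic[OF y x])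
  have T: "(1 - fps_X ^ k) * T k = Z0 + fps_const (of_nat k + 1) * Z1 + fps_const ((of_nat k ^ 3 - of_nat k) / 6) * Z3" for k
    using comm[of "int k"] unfolding yx T_def[symmetric] by (simp add: algebra_simps)
  have R: "(1 - fps_X ^ k) * R k = - (Z0 + fps_const (1 - of_nat k) * Z1 - fps_const ((of_nat k ^ 3 - of_nat k) / 6) * Z3)" for k
  proof -
    have e: "of_int (- int k + 1) = (1 - of_nat k :: complex)"
      "of_int ((- int k) ^ 3 - (- int k)) / 6 = - ((of_nat k ^ 3 - of_nat k) / 6 :: complex)"
      by (simp_all add: power3_eq_cube field_simps)
    have "fps_X ^ k * R k - R k = Z0 + fps_const (1 - of_nat k) * Z1 + fps_const (- ((of_nat k ^ 3 - of_nat k) / 6)) * Z3"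
      using comm[of "- int k"] unfolding minus_minus xy' R_def[symmetric] e .
    then show ?thesis by (simp add: algebra_simps flip: fps_const_neg)
  qed
  \<comment> \<open>for \<open>k = 0\<close> the trace of the commutator vanishes\<close>
  have Z0: "Z0 = - Z1"
    using T[of 0] by (simp add: eq_neg_iff_add_eq_0)
  \<comment> \<open>the stray term \<open>y\<^sub>1 x\<^sub>-\<^sub>1\<close> stands in for the missing \<open>x\<^sub>-\<^sub>1 y\<^sub>1\<close>, up to a commutator\<close>
  have R1: "R 1 = fps_X * R 1 + Z1"
    using R[of 1] by (simp add: Z0 algebra_simps)
  have TR: "fps_X ^ k * (T k + R k) = multiples_series k * (fps_const (of_nat k) * (fps_const 2 * Z1))
      + multiples_series k * (fps_const (of_nat k ^ 3 - of_nat k) * (fps_const (1 / 3) * Z3))" if "k > 0" for k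
  proof -
    have e: "fps_const (of_nat k + 1) - fps_const (1 - of_nat k) = fps_const (of_nat k) * fps_const (2 :: complex)"
      "fps_const (t / 6) + fps_const (t / 6) = fps_const t * fps_const (1 / 3 :: complex)" for t
      by (simp_all add: mult.commute)
    have ring: "z0 + p * z1 + t * z3 + - (z0 + m * z1 - t * z3) = (p - m) * z1 + (t + t) * z3"
      for z0 z1 z3 p m t :: "complex fps" by (simp add: algebra_simps)
    have "(1 - fps_X ^ k) * (T k + R k) = (fps_const (of_nat k + 1) - fps_const (1 - of_nat k)) * Z1 +
        (fps_const ((of_nat k ^ 3 - of_nat k) / 6) + fps_const ((of_nat k ^ 3 - of_nat k) / 6)) * Z3"
      unfolding distrib_left T R by (rule ring)
    also have "\<dots> = fps_const (of_nat k) * (fps_const 2 * Z1) + fps_const (of_nat k ^ 3 - of_nat k) * (fps_const (1 / 3) * Z3)"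
      by (simp only: e mult.assoc)
    finally have "fps_X ^ k * (T k + R k) = multiples_series k * (fps_const (of_nat k) * (fps_const 2 * Z1)
        + fps_const (of_nat k ^ 3 - of_nat k) * (fps_const (1 / 3) * Z3))"
      by (rule geometric_solution[OF that])
    then show ?thesis by (simp only: distrib_left[of "multiples_series k"])
  qed
  have coeff: "fps_nth (gtr (mode V (a\<^bsub>(-1)\<^esub> b) 3)) n = fps_nth (F + Z1 + divisor_series of_nat * (fps_const 2 * Z1)
      + divisor_series (\<lambda>k. of_nat k ^ 3 - of_nat k) * (fps_const (1 / 3) * Z3)) n" for n
  proof -
    let ?tr = "trace_on (smul V) (weight (int n))"
    let ?f = "\<lambda>i v. ?x (- int (i + 2)) (?y (int (i + 2)) v)"
    let ?g = "\<lambda>i v. ?y (- (int i - 1)) (?x (int i - 1) v)"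
    have F: "F = T 0" by (simp add: F_def T_def)
    \<comment> \<open>\<open>x\<^sub>-\<^sub>1 y\<^sub>1\<close> completes the sum over \<open>k \<ge> 2\<close> to one over \<open>k \<ge> 1\<close>\<close>
    have "n + 3 = Suc (n + 2)" by simp
    then have shift: "(\<Sum>i<n + 3. fps_nth (fps_X ^ (i + 1) * R (i + 1)) n) =
        fps_nth (fps_X ^ 1 * R 1) n + (\<Sum>i<n + 2. fps_nth (fps_X ^ (i + 2) * R (i + 2)) n)"
      by (simp only: sum.lessThan_Suc_shift) simp
    have f0: "lowers 0 (?f i)" and g0: "lowers 0 (?g i)" for i by (rule xy)+
    \<comment> \<open>on weight \<open>n\<close> the terms of the iterate formula with \<open>i \<ge> n + 2\<close> pass through negative weights\<close>
    have "?tr (mode V (a\<^bsub>(-1)\<^esub> b) 3) = ?tr (\<lambda>v. \<Sum>i<n + 2. ?f i v + ?g i v)"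
    proof (rule trace_on_cong[OF fin_dim_weight])
      fix v assume v: "v \<in> weight (int n)"
      have "(a\<^bsub>(-1)\<^esub> b)\<^bsub>(3)\<^esub> v =
          (\<Sum>i<n + 2. a\<^bsub>(- 1 - int i)\<^esub> (b\<^bsub>(3 + int i)\<^esub> v) + b\<^bsub>(3 - 1 - int i)\<^esub> (a\<^bsub>(int i)\<^esub> v))"
        by (rule iterate_minus_one)
          (use weight_mode[OF _ b v] weight_mode[OF _ a v] weight_negative in fastforce)+
      also have "\<dots> = (\<Sum>i<n + 2. ?f i v + ?g i v)"
        by (rule sum.cong) (simp_all add: algebra_simps)
      finally show "(a\<^bsub>(-1)\<^esub> b)\<^bsub>(3)\<^esub> v = (\<Sum>i<n + 2. ?f i v + ?g i v)" .
    qed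
    also have "\<dots> = (\<Sum>i<n + 2. ?tr (?f i) + ?tr (?g i))"
      by (subst trace_on_sum[OF fin_dim_weight])
        (use lowers_0[OF f0] lowers_0[OF g0] in
          \<open>simp_all add: trace_on_add[OF fin_dim_weight] subspace_add[OF subspace_weight]\<close>)
    also have "\<dots> = (\<Sum>i<n + 2. fps_nth (fps_X ^ (i + 2) * R (i + 2)) n) + (\<Sum>i<n + 2. ?tr (?g i))"
      unfolding sum.distrib gtr_nth[symmetric] xy' ..
    also have "(\<Sum>i<n + 2. ?tr (?g i)) = fps_nth (R 1) n + (fps_nth (T 0) n + (\<Sum>i<n. fps_nth (fps_X ^ (i + 1) * T (i + 1)) n))"
    proof -
      have "?tr (?g (Suc (Suc i))) = fps_nth (fps_X ^ (i + 1) * T (i + 1)) n" for i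
        unfolding yx[of "i + 1", symmetric] gtr_nth by simp
      moreover have "?tr (?g (Suc 0)) = fps_nth (T 0) n"
        using yx[of 0] unfolding gtr_nth[symmetric] by simp
      moreover have "?tr (?g 0) = fps_nth (R 1) n"
        unfolding R_def gtr_nth by simp
      ultimately show ?thesis by (simp only: add_2_eq_Suc' sum.lessThan_Suc_shift)
    qed
    also have "fps_nth (R 1) n = fps_nth Z1 n + fps_nth (fps_X ^ 1 * R 1) n"
      using arg_cong[OF R1, of "\<lambda>f. fps_nth f n"] by simp
    also have "(\<Sum>i<n + 2. fps_nth (fps_X ^ (i + 2) * R (i + 2)) n) + (fps_nth Z1 n + fps_nth (fps_X ^ 1 * R 1) n
          + (fps_nth (T 0) n + (\<Sum>i<n. fps_nth (fps_X ^ (i + 1) * T (i + 1)) n))) =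
        fps_nth (F + Z1) n + ((\<Sum>i<n + 3. fps_nth (fps_X ^ (i + 1) * R (i + 1)) n) + (\<Sum>i<n. fps_nth (fps_X ^ (i + 1) * T (i + 1)) n))"
      by (simp only: shift F fps_add_nth add_ac)
    also have "(\<Sum>i<n + 3. fps_nth (fps_X ^ (i + 1) * R (i + 1)) n) = (\<Sum>i<n. fps_nth (fps_X ^ (i + 1) * R (i + 1)) n)"
      by (rule sum.mono_neutral_right) (auto simp: fps_X_power_mult_nth simp del: power_Suc)
    also have "\<dots> + (\<Sum>i<n. fps_nth (fps_X ^ (i + 1) * T (i + 1)) n) = (\<Sum>i<n. fps_nth (fps_X ^ (i + 1) * (T (i + 1) + R (i + 1))) n)"
      by (simp add: distrib_left sum.distrib)
    also have "\<dots> = (\<Sum>k=1..n. fps_nth (fps_X ^ k * (T k + R k)) n)"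
      by (simp add: sum.atLeast1_atMost_eq)
    also have "\<dots> = (\<Sum>k=1..n. fps_nth (multiples_series k * (fps_const (of_nat k) * (fps_const 2 * Z1))) n
        + fps_nth (multiples_series k * (fps_const (of_nat k ^ 3 - of_nat k) * (fps_const (1 / 3) * Z3))) n)"
      by (rule sum.cong) (simp_all only: TR fps_add_nth, simp_all add: TR)
    also have "\<dots> = fps_nth (divisor_series of_nat * (fps_const 2 * Z1)) n
        + fps_nth (divisor_series (\<lambda>k. of_nat k ^ 3 - of_nat k) * (fps_const (1 / 3) * Z3)) n"
      unfolding sum.distrib sum_multiples_series ..
    finally show ?thesis by (simp add: gtr_nth add.assoc)
  qed
  have "divisor_series (\<lambda>k. of_nat k ^ 3 - of_nat k) = S3 - S1"
    by (rule fps_ext) (simp add: divisor_series_def S1_def S3_def sum_subtractf)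
  then have "gtr (mode V (a\<^bsub>(-1)\<^esub> b) 3) = F + Z1 + S1 * (fps_const 2 * Z1) + (S3 - S1) * (fps_const (1 / 3) * Z3)"
    by (intro fps_ext) (simp only: coeff S1_def)
  then have "F = gtr (mode V (a\<^bsub>(-1)\<^esub> b) 3) - (1 + fps_const 2 * S1) * Z1
      - (fps_const (1 / 3) * fps_const (griess_form V a b)) * (S3 - S1) * ch V"
    by (simp add: Z3_def algebra_simps)
  moreover have "fps_const (1 / 3) * fps_const (griess_form V a b) = fps_const (griess_form V a b / 3)" by simp
  ultimately show ?thesis by (simp only: F_def Z1_def add_0)
qed

section \<open>Invariance of the traces under automorphisms\<close>

lemma lowers_zero_mode: "j \<noteq> 0 \<Longrightarrow> u \<in> weight j \<Longrightarrow> lowers 0 (mode V u (j - 1))"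
  using lowers_mode[of j u 0] by simp

text \<open>Since \<open>o(g u) = g o(u) g\<^sup>-\<^sup>1\<close>, the trace of \<open>o(u)\<close> depends only on the average of \<open>u\<close>.\<close>

lemma gtr_Aut:
  assumes g: "g \<in> Aut V" and u: "j \<noteq> 0" "u \<in> weight j"
  shows "gtr (mode V (g u) (j - 1)) = gtr (mode V u (j - 1))"
proof -
  have lin: "lowers 0 h" if "h \<in> Aut V" for h
    using that by (simp add: lowers_def linear_on_def Aut_weight Aut_add Aut_scale)
  have b: "bij g" by (rule Aut_bij[OF g])
  have gi: "g (inv g v) = v" "inv g (g v) = v" for v
    using b by (simp_all add: bij_is_surj bij_is_inj surj_f_inv_f)
  have "gtr (mode V (g u) (j - 1)) = gtr (\<lambda>v. g (u\<^bsub>(j - 1)\<^esub> (inv g v)))"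
    by (rule gtr_cong) (simp add: Aut_mode[OF g] gi)
  also have "\<dots> = gtr (\<lambda>v. inv g (g (u\<^bsub>(j - 1)\<^esub> v)))"
    using gtr_cyclic[of 0 "inv g" "\<lambda>v. g (u\<^bsub>(j - 1)\<^esub> v)"] lin[OF Aut_inv[OF g]]
      lowers_comp[OF lin[OF g] lowers_zero_mode[OF u]] by simp
  finally show ?thesis by (simp add: gi)
qed

lemma gtr_linear_vector:
  assumes u: "j > 0" "u \<in> weight j" and w: "w \<in> weight j"
  shows "gtr (mode V (x \<cdot> u + y \<cdot> w) (j - 1)) =
    fps_const x * gtr (mode V u (j - 1)) + fps_const y * gtr (mode V w (j - 1))"
proof -
  have l: "lowers 0 (mode V u (j - 1))" "lowers 0 (mode V w (j - 1))"
    using lowers_zero_mode u w by auto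
  have "gtr (mode V (x \<cdot> u + y \<cdot> w) (j - 1)) = gtr (\<lambda>v. x \<cdot> u\<^bsub>(j - 1)\<^esub> v + y \<cdot> w\<^bsub>(j - 1)\<^esub> v)"
    by (rule gtr_cong) (use u(1) in \<open>simp add: mode_nonneg_left\<close>)
  then show ?thesis by (simp only: gtr_add[OF lowers_scale lowers_scale, OF l] gtr_scale l)
qed

context
  assumes finite_Aut: "finite (Aut V)"
begin

lemma gtr_avg:
  assumes u: "j > 0" "u \<in> weight j"
  shows "gtr (mode V (avg u) (j - 1)) = gtr (mode V u (j - 1))"
proof -
  let ?N = "of_nat (card (Aut V)) :: complex"
  have l: "lowers 0 (mode V (g u) (j - 1))" if "g \<in> Aut V" for g
    using lowers_zero_mode Aut_weight[OF that] u by simp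
  have sum_l: "lowers 0 (\<lambda>v. \<Sum>g\<in>A. (g u)\<^bsub>(j - 1)\<^esub> v)" if "A \<subseteq> Aut V" "finite A" for A
    using that(2,1)
  proof induction
    case empty
    then show ?case using lowers_scale[OF lowers_ident, of 0] by simp
  next
    case (insert g A)
    then have "lowers 0 (\<lambda>v. (g u)\<^bsub>(j - 1)\<^esub> v + (\<Sum>g\<in>A. (g u)\<^bsub>(j - 1)\<^esub> v))"
      by (intro lowers_add l) auto
    then show ?case using insert.hyps by simp
  qed
  have mode_sum: "(sum f A)\<^bsub>(j - 1)\<^esub> v = (\<Sum>g\<in>A. (f g)\<^bsub>(j - 1)\<^esub> v)" for f A v
    using u(1) by (induction A rule: infinite_finite_induct) (simp_all add: mode_nonneg_left)
  have "gtr (mode V (avg u) (j - 1)) = gtr (\<lambda>v. (1 / ?N) \<cdot> (\<Sum>g\<in>Aut V. (g u)\<^bsub>(j - 1)\<^esub> v))"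
    by (rule gtr_cong) (simp add: avg_def mode_scale_left mode_sum)
  also have "\<dots> = fps_const (1 / ?N) * gtr (\<lambda>v. \<Sum>g\<in>Aut V. (g u)\<^bsub>(j - 1)\<^esub> v)"
    by (rule gtr_scale) (simp add: sum_l finite_Aut)
  also have "gtr (\<lambda>v. \<Sum>g\<in>Aut V. (g u)\<^bsub>(j - 1)\<^esub> v) = (\<Sum>g\<in>Aut V. gtr (mode V (g u) (j - 1)))"
    using gtr_sum[OF finite_Aut, of "\<lambda>g. mode V (g u) (j - 1)"] l by simp
  also have "\<dots> = (\<Sum>g\<in>Aut V. gtr (mode V u (j - 1)))"
    by (rule sum.cong) (use gtr_Aut u in auto)
  also have "fps_const (1 / ?N) * \<dots> = (fps_const (1 / ?N) * fps_const ?N) * gtr (mode V u (j - 1))"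
    by (simp add: fps_of_nat mult.assoc)
  also have "fps_const (1 / ?N) * fps_const ?N = 1"
    using card_Aut[OF finite_Aut] by simp
  finally show ?thesis by simp
qed

lemma trace_zero_mode:
  assumes S: "class_S V n" "n \<ge> 2" and a: "a \<in> weight 2"
  shows "gtr (mode V a 1) = fps_const (2 * griess_form V a \<omega> / c) * q_deriv (ch V)"
proof -
  have "gtr (mode V a 1) = gtr (mode V (avg a) 1)" using gtr_avg[of 2 a] a by simp
  also have "\<dots> = fps_const (2 * griess_form V a \<omega> / c) * gtr (mode V \<omega> 1)"
    using gtr_linear_vector[of 2 \<omega> \<omega> "2 * griess_form V a \<omega> / c" 0] conf_weight
    by (simp add: avg_griess[OF finite_Aut S a])
  finally show ?thesis by (simp add: gtr_L0)
qed

lemma mode_3_virasoro_4: "(L (-4) \<one>)\<^bsub>(3)\<^esub> v = 3 \<cdot> \<omega>\<^bsub>(1)\<^esub> v"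
proof -
  have "2 \<cdot> L (-4) \<one> = L (-1) (L (-1) \<omega>)"
    by (simp add: translation_conf translation_virasoro_3)
  moreover have "L (-1) \<omega> \<in> range (L 0)"
    using virasoro_weight[OF conf_weight, of "-1"] by (intro weight_range_L0[of 3]) simp_all
  ultimately have "(2 \<cdot> L (-4) \<one>)\<^bsub>(3)\<^esub> v = 6 \<cdot> \<omega>\<^bsub>(1)\<^esub> v"
    using translation_range_L0[of "L (-1) \<omega>" 3 v] translation_range_L0[OF conf_range_L0, of 2 v] by simp
  then have "2 \<cdot> (L (-4) \<one>)\<^bsub>(3)\<^esub> v = 2 \<cdot> (3 \<cdot> \<omega>\<^bsub>(1)\<^esub> v)" by (simp add: mode_scale_left)
  then show ?thesis by (rule scale_left_imp_eq[rotated]) simp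
qed

text \<open>
  Averaging replaces \<open>a\<^sub>(\<^sub>-\<^sub>1\<^sub>) b\<close> by \<open>\<alpha> L\<^sub>-\<^sub>2 \<omega> + \<beta> L\<^sub>-\<^sub>4 \<one>\<close>. The trace for \<open>L\<^sub>-\<^sub>2 \<omega> = \<omega>\<^sub>(\<^sub>-\<^sub>1\<^sub>) \<omega>\<close> is read off from the
  recursion in the case \<open>a = b = \<omega>\<close>, where the left side is the trace of \<open>L\<^sub>0\<^sup>2\<close>.
\<close>

lemma trace_product_zero_modes:
  assumes S: "class_S V 4" and c: "5 * c + 22 \<noteq> 0" and a: "a \<in> weight 2" and b: "b \<in> weight 2"
  defines "A \<equiv> griess_form V a b" and "p \<equiv> griess_form V a \<omega> * griess_form V b \<omega>"
  defines "S1 \<equiv> divisor_series of_nat" and "S3 \<equiv> divisor_series (\<lambda>k. of_nat k ^ 3)"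
  shows "gtr (\<lambda>v. a\<^bsub>(1)\<^esub> (b\<^bsub>(1)\<^esub> v)) =
    fps_const ((44 * A + 20 * p) / (c * (5 * c + 22))) * q_deriv (q_deriv (ch V))
    - (6 + fps_const 120 * S1) * fps_const ((c * A - 2 * p) / (3 * c * (5 * c + 22))) * q_deriv (ch V)
    + fps_const 240 * (S1 - S3) * fps_const ((c * A - 2 * p) / (144 * (5 * c + 22))) * ch V"
proof -
  define \<alpha> where "\<alpha> = (44 * A + 20 * p) / (c * (5 * c + 22))"
  define \<beta> where "\<beta> = (6 * A - 3 * c * \<alpha>) / (5 * c)"
  define K where "K = c * A - 2 * p"
  let ?C = "ch V" and ?C1 = "q_deriv (ch V)" and ?C2 = "q_deriv (q_deriv (ch V))"
  have coeffs: "2 * \<alpha> + 3 * \<beta> - 4 * A / c = - 6 * (K / (3 * c * (5 * c + 22)))"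
    "4 * \<alpha> - 8 * A / c = - 120 * (K / (3 * c * (5 * c + 22)))"
    "\<alpha> * c / 6 - A / 3 = - 240 * (K / (144 * (5 * c + 22)))"
  proof -
    define d where "d = 5 * c + 22"
    have d: "d \<noteq> 0" using c by (simp add: d_def)
    have \<alpha>: "\<alpha> * (c * d) = 44 * A + 20 * p" and \<beta>: "\<beta> * (5 * c) = 6 * A - 3 * c * \<alpha>"
      using d rank_nonzero by (simp_all add: \<alpha>_def \<beta>_def d_def)
    have "2 * \<alpha> + 3 * \<beta> - 4 * A / c = - 6 * (K / (3 * c * d))"
    proof -
      have "(5 * c * d) * (2 * \<alpha> + 3 * \<beta> - 4 * A / c) = 10 * (\<alpha> * (c * d)) + 3 * d * (\<beta> * (5 * c)) - 20 * d * A"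
        using rank_nonzero by (simp add: field_simps)
      also have "\<dots> = 10 * (\<alpha> * (c * d)) + 3 * (6 * A * d - 3 * (\<alpha> * (c * d))) - 20 * d * A"
        unfolding \<beta> by (simp add: algebra_simps)
      also have "\<dots> = - 10 * K"
        unfolding \<alpha> by (simp add: K_def d_def algebra_simps)
      also have "\<dots> = (5 * c * d) * (- 6 * (K / (3 * c * d)))"
        using rank_nonzero d by (simp add: field_simps)
      finally show ?thesis using rank_nonzero d by (simp only: mult_cancel_left) simp
    qed
    moreover have "4 * \<alpha> - 8 * A / c = - 120 * (K / (3 * c * d))"
    proof -
      have "(c * d) * (4 * \<alpha> - 8 * A / c) = 4 * (\<alpha> * (c * d)) - 8 * A * d"
        using rank_nonzero by (simp add: field_simps)
      also have "\<dots> = - 40 * K" unfolding \<alpha> by (simp add: K_def d_def algebra_simps)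
      also have "\<dots> = (c * d) * (- 120 * (K / (3 * c * d)))"
        using rank_nonzero d by (simp add: field_simps)
      finally show ?thesis using rank_nonzero d by (simp only: mult_cancel_left) simp
    qed
    moreover have "\<alpha> * c / 6 - A / 3 = - 240 * (K / (144 * d))"
    proof -
      have "d * (\<alpha> * c / 6 - A / 3) = (\<alpha> * (c * d)) / 6 - A * d / 3" by (simp add: field_simps)
      also have "\<dots> = - 5 * K / 3" unfolding \<alpha> by (simp add: K_def d_def field_simps)
      also have "\<dots> = d * (- 240 * (K / (144 * d)))" using d by (simp add: field_simps)
      finally show ?thesis using d by (simp only: mult_cancel_left) simp
    qed
    ultimately show "2 * \<alpha> + 3 * \<beta> - 4 * A / c = - 6 * (K / (3 * c * (5 * c + 22)))"
      "4 * \<alpha> - 8 * A / c = - 120 * (K / (3 * c * (5 * c + 22)))"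
      "\<alpha> * c / 6 - A / 3 = - 240 * (K / (144 * (5 * c + 22)))"
      by (simp_all only: d_def)
  qed
  have w4: "L (-2) \<omega> \<in> weight 4" "L (-4) \<one> \<in> weight 4"
    using virasoro_weight[OF conf_weight, of "-2"] virasoro_weight[OF vac_weight, of "-4"] by simp_all
  have "a\<^bsub>(-1)\<^esub> b \<in> weight 4" using weight_mode[OF _ a b, of "-1"] by simp
  then have "gtr (mode V (a\<^bsub>(-1)\<^esub> b) 3) = gtr (mode V (avg (a\<^bsub>(-1)\<^esub> b)) 3)"
    using gtr_avg[of 4] by simp
  also have "avg (a\<^bsub>(-1)\<^esub> b) = \<alpha> \<cdot> L (-2) \<omega> + \<beta> \<cdot> L (-4) \<one>"
    using avg_normal_product[OF finite_Aut S c a b] by (simp add: \<alpha>_def \<beta>_def A_def p_def mult.assoc)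
  also have "gtr (mode V (\<alpha> \<cdot> L (-2) \<omega> + \<beta> \<cdot> L (-4) \<one>) 3) =
      fps_const \<alpha> * gtr (mode V (L (-2) \<omega>) 3) + fps_const \<beta> * gtr (mode V (L (-4) \<one>) 3)"
    using gtr_linear_vector[of 4, OF _ w4] by simp
  also have "gtr (mode V (L (-4) \<one>) 3) = fps_const 3 * ?C1"
    using gtr_scale[of "mode V \<omega> 1" 3] lowers_zero_mode[OF _ conf_weight]
    by (simp add: mode_3_virasoro_4[abs_def] gtr_L0)
  finally have normal: "gtr (mode V (a\<^bsub>(-1)\<^esub> b) 3) =
      fps_const \<alpha> * gtr (mode V (L (-2) \<omega>) 3) + fps_const \<beta> * (fps_const 3 * ?C1)" .
  have ab: "a\<^bsub>(1)\<^esub> b \<in> weight 2" using weight_mode[OF _ a b, of 1] by simp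
  have "gtr (mode V (a\<^bsub>(1)\<^esub> b) 1) = gtr (mode V (avg (a\<^bsub>(1)\<^esub> b)) 1)" using gtr_avg[of 2] ab by simp
  also have "\<dots> = fps_const (4 * A / c) * ?C1"
    using gtr_linear_vector[of 2 \<omega> \<omega> "4 * A / c" 0] conf_weight
    by (simp add: avg_griess_product[OF finite_Aut S _ a b] A_def gtr_L0)
  finally have prod: "gtr (mode V (a\<^bsub>(1)\<^esub> b) 1) = fps_const (4 * A / c) * ?C1" .
  have "\<omega>\<^bsub>(1)\<^esub> \<omega> = 2 \<cdot> \<omega>" using virasoro_conf[of 0] by (simp add: virasoro_def)
  then have "gtr (mode V (\<omega>\<^bsub>(1)\<^esub> \<omega>) 1) = fps_const 2 * ?C1"
    using gtr_linear_vector[of 2 \<omega> \<omega> 2 0] conf_weight by (simp add: gtr_L0)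
  moreover have "\<omega>\<^bsub>(-1)\<^esub> \<omega> = L (-2) \<omega>" by (simp add: virasoro_def)
  ultimately have square: "gtr (mode V (L (-2) \<omega>) 3) =
      ?C2 + (1 + fps_const 2 * S1) * (fps_const 2 * ?C1) + fps_const (c / 6) * (S3 - S1) * ?C"
    using trace_recursion[OF conf_weight conf_weight]
    by (simp add: gtr_L0_L0 griess_form_conf S1_def S3_def)
  have rec: "gtr (\<lambda>v. a\<^bsub>(1)\<^esub> (b\<^bsub>(1)\<^esub> v)) =
      fps_const \<alpha> * (?C2 + (1 + fps_const 2 * S1) * (fps_const 2 * ?C1) + fps_const (c / 6) * (S3 - S1) * ?C)
      + fps_const \<beta> * (fps_const 3 * ?C1) - (1 + fps_const 2 * S1) * (fps_const (4 * A / c) * ?C1)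
      - fps_const (A / 3) * (S3 - S1) * ?C"
    unfolding trace_recursion[OF a b] normal prod square by (simp add: A_def S1_def S3_def)
  also have "\<dots> = fps_const \<alpha> * ?C2
      + (fps_const (2 * \<alpha> + 3 * \<beta> - 4 * A / c) + fps_const (4 * \<alpha> - 8 * A / c) * S1) * ?C1
      + fps_const (\<alpha> * c / 6 - A / 3) * (S3 - S1) * ?C"
  proof -
    have "fps_const (2 * \<alpha> + 3 * \<beta> - 4 * A / c) = fps_const \<alpha> * fps_const 2 + fps_const \<beta> * fps_const 3 - fps_const (4 * A / c)"
      "fps_const (4 * \<alpha> - 8 * A / c) = fps_const 2 * fps_const \<alpha> * fps_const 2 - fps_const 2 * fps_const (4 * A / c)"
      "fps_const (\<alpha> * c / 6 - A / 3) = fps_const \<alpha> * fps_const (c / 6) - fps_const (A / 3)"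
      by (simp_all add: mult.commute)
    moreover have "al * (C2 + (1 + t * S1) * (t * C1) + k * (S3 - S1) * C) + be * (th * C1)
        - (1 + t * S1) * (m * C1) - a3 * (S3 - S1) * C =
        al * C2 + ((al * t + be * th - m) + (t * al * t - t * m) * S1) * C1 + (al * k - a3) * (S3 - S1) * C"
      for al be t th k m a3 C C1 C2 :: "complex fps" by (simp add: algebra_simps)
    ultimately show ?thesis by (simp only:)
  qed
  also have "2 * \<alpha> + 3 * \<beta> - 4 * A / c = - 6 * (K / (3 * c * (5 * c + 22)))" by (rule coeffs)
  also have "4 * \<alpha> - 8 * A / c = - 120 * (K / (3 * c * (5 * c + 22)))" by (rule coeffs)
  also have "\<alpha> * c / 6 - A / 3 = - 240 * (K / (144 * (5 * c + 22)))" by (rule coeffs)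
  also have "fps_const \<alpha> * ?C2
      + (fps_const (- 6 * (K / (3 * c * (5 * c + 22)))) + fps_const (- 120 * (K / (3 * c * (5 * c + 22)))) * S1) * ?C1
      + fps_const (- 240 * (K / (144 * (5 * c + 22)))) * (S3 - S1) * ?C =
      fps_const \<alpha> * ?C2 - (6 + fps_const 120 * S1) * fps_const (K / (3 * c * (5 * c + 22))) * ?C1
      + fps_const 240 * (S1 - S3) * fps_const (K / (144 * (5 * c + 22))) * ?C"
  proof -
    have "fps_const (- 6 * x) = - 6 * fps_const x" "fps_const (- 120 * x) = - (fps_const 120 * fps_const x)"
      "fps_const (- 240 * x) = - (fps_const 240 * fps_const x)" for x :: complex
      by (simp_all add: numeral_fps_const)
    moreover have "al * C2 + (- 6 * k + - (t * k) * S1) * C1 + - (u * l) * (S3 - S1) * C =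
        al * C2 - (6 + t * S1) * k * C1 + u * (S1 - S3) * l * C"
      for al k l t u C C1 C2 :: "complex fps" by (simp add: algebra_simps)
    ultimately show ?thesis by (simp only:)
  qed
  finally show ?thesis unfolding \<alpha>_def K_def .
qed

end

end

section \<open>The trace formulae\<close>

theorem theorem5p1:
  fixes V :: "('v::ab_group_add) voa_data" and c :: complex
  assumes "vertex_operator_algebra V c"
    and "weight_space V 0 = module.span (smul V) {vac V}"
    and "weight_space V 1 = {0}"
    and "finite (Aut V)"
  shows
    "(class_S V 2 \<and> c \<noteq> 0 \<longrightarrow>
       (\<forall>a \<in> griess V.
          graded_trace V (zero_mode V 2 a) =
            fps_const (2 * griess_form V a (conf V) / c) * q_deriv (ch V))) \<and>
     (class_S V 4 \<and> c * (5 * c + 22) \<noteq> 0 \<longrightarrow>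
       (\<forall>a \<in> griess V. \<forall>b \<in> griess V.
          graded_trace V (zero_mode V 2 a \<circ> zero_mode V 2 b) =
            fps_const ((44 * griess_form V a b
                + 20 * griess_form V a (conf V) * griess_form V b (conf V))
              / (c * (5 * c + 22))) * q_deriv (q_deriv (ch V))
            - (11 + 60 * eisenstein 2)
              * fps_const ((c * griess_form V a b
                  - 2 * griess_form V a (conf V) * griess_form V b (conf V))
                / (3 * c * (5 * c + 22))) * q_deriv (ch V)
            + (11 + 120 * eisenstein 2 - 720 * eisenstein 4)
              * fps_const ((c * griess_form V a b
                  - 2 * griess_form V a (conf V) * griess_form V b (conf V))
                / (144 * (5 * c + 22))) * ch V))"
proof -
  have voa: "griess_voa V c" if "c \<noteq> 0"
    using assms(1-3) that by (simp add: griess_voa_def griess_voa_axioms_def)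
  have zero_mode: "zero_mode V 2 a = mode V a 1" for a
    by (simp add: zero_mode_def fun_eq_iff)
  have E2: "11 + 60 * eisenstein 2 = 6 + fps_const 120 * divisor_series of_nat"
    by (simp add: eisenstein_2)
  have "120 * eisenstein 2 = 2 * (60 * eisenstein 2)" by simp
  also have "\<dots> = 2 * (fps_const 120 * divisor_series of_nat - 5)" by (simp only: eisenstein_2)
  also have "\<dots> = fps_const 240 * divisor_series of_nat - 10"
    by (simp add: numeral_fps_const[symmetric] right_diff_distrib)
  finally have E4: "11 + 120 * eisenstein 2 - 720 * eisenstein 4 =
      fps_const 240 * (divisor_series of_nat - divisor_series (\<lambda>k. of_nat k ^ 3))"
    by (simp add: eisenstein_4 right_diff_distrib)
  show ?thesis
  proof (intro conjI impI ballI)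
    fix a assume *: "class_S V 2 \<and> c \<noteq> 0" and a: "a \<in> griess V"
    then interpret griess_voa V c using voa by blast
    show "graded_trace V (zero_mode V 2 a) =
        fps_const (2 * griess_form V a (conf V) / c) * q_deriv (ch V)"
      using trace_zero_mode[OF assms(4), of 2 a] * a by (simp add: zero_mode griess_weight)
  next
    fix a b assume *: "class_S V 4 \<and> c * (5 * c + 22) \<noteq> 0" and a: "a \<in> griess V" and b: "b \<in> griess V"
    then interpret griess_voa V c using voa by simp
    have "graded_trace V (zero_mode V 2 a \<circ> zero_mode V 2 b) = gtr (\<lambda>v. mode V a 1 (mode V b 1 v))"
      by (simp add: zero_mode comp_def)
    then show "graded_trace V (zero_mode V 2 a \<circ> zero_mode V 2 b) =
            fps_const ((44 * griess_form V a b
                + 20 * griess_form V a (conf V) * griess_form V b (conf V))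
              / (c * (5 * c + 22))) * q_deriv (q_deriv (ch V))
            - (11 + 60 * eisenstein 2)
              * fps_const ((c * griess_form V a b
                  - 2 * griess_form V a (conf V) * griess_form V b (conf V))
                / (3 * c * (5 * c + 22))) * q_deriv (ch V)
            + (11 + 120 * eisenstein 2 - 720 * eisenstein 4)
              * fps_const ((c * griess_form V a b
                  - 2 * griess_form V a (conf V) * griess_form V b (conf V))
                / (144 * (5 * c + 22))) * ch V"
      unfolding E2 E4
      using trace_product_zero_modes[OF assms(4), of a b] * a b by (simp only: griess_weight mult.assoc) simp
  qed
qed

end
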